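(* Let $n\ge 2$, $\gamma\in(0,n-1)$ and $\alpha\in(0,\infty)$. There are constants $C_1$ (depending only on $n,\gamma,\alpha$) and $C_2$ (depending only on $n$) such that for every $f\in BV(\mathbb{R}^n)$, $$\left\|m^L_{\alpha,\gamma}[f]\right\|_{L^{n/(n-(1+\gamma)),1}} \le C_1\,\|f\|_{L^{n/(n-1),1}},$$ and, for every non-negative $f\in BV(\mathbb{R}^n)$, $$\|f\|_{L^{n/(n-1),1}}\le C_2\,|f|_{BV}.$$
   Context: For $f\in L^1_{loc}(\mathbb{R}^n)$, $$|f|_{BV} := \sup\left\{\int_{\mathbb{R}^n} f\,\mathrm{div}\,\Phi\,dx : \Phi\in C_0^\infty(\mathbb{R}^n;\mathbb{R}^n),\ \|\Phi\|_{L^\infty}\le 1\right\},$$ $\|f\|_{BV}:=\|f\|_{L^1}+|f|_{BV}$, and $BV(\mathbb{R}^n)$ is the space of real-valued functions $f$ with $\|f\|_{BV}<\infty$. $|\cdot|$ of a set denotes Lebesgue measure, and $d_f(\lambda) := |\{x\in\mathbb{R}^n : |f(x)|>\lambda\}|$. For $0<p<\infty$, $\|f\|_{L^{p,1}} := p\int_0^\infty d_f(\lambda)^{1/p}\,d\lambda$. For $t\ge 0$, $L[f](t) := \inf\{\lambda\ge 0 : d_f(\lambda)<t\}$, with $\inf\emptyset:=\infty$, and $$m^L_{\alpha,\gamma}[f](x) := \sup_{Q} L[f\chi_Q]\left(\alpha|Q|^{1-\gamma/n}\right)\chi_Q(x),$$ the supremum being over all cubes $Q\subset\mathbb{R}^n$.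 *)

theory Defs
  imports "HOL-Probability.Essential_Supremum"
begin

definition partial :: "'n::finite \<Rightarrow> (real ^ 'n \<Rightarrow> real) \<Rightarrow> real ^ 'n \<Rightarrow> real" where
  "partial i f x = frechet_derivative f (at x) (axis i 1)"

fun C_k :: "nat \<Rightarrow> (real ^ 'n::finite \<Rightarrow> real) \<Rightarrow> bool" where
  "C_k 0 f \<longleftrightarrow> continuous_on UNIV f"
| "C_k (Suc k) f \<longleftrightarrow> (\<forall>x. f differentiable (at x)) \<and> (\<forall>i. C_k k (partial i f))"

definition smooth :: "(real ^ 'n::finite \<Rightarrow> real) \<Rightarrow> bool" where
  "smooth f \<longleftrightarrow> (\<forall>k. C_k k f)"

definition divergence :: "(real ^ 'n::finite \<Rightarrow> real ^ 'n) \<Rightarrow> real ^ 'n \<Rightarrow> real" where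
  "divergence \<Phi> x = (\<Sum>i\<in>UNIV. partial i (\<lambda>y. \<Phi> y $ i) x)"

definition test_fields :: "(real ^ 'n::finite \<Rightarrow> real ^ 'n) set" where
  "test_fields = {\<Phi>. (\<forall>i. smooth (\<lambda>x. \<Phi> x $ i)) \<and> compact (closure {x. \<Phi> x \<noteq> 0})
     \<and> esssup lebesgue (\<lambda>x. ereal (norm (\<Phi> x))) \<le> 1}"

(* ennreal truncates negative integrals to 0; this does not change the supremum,
   because the zero field is a test field. *)
definition BV_seminorm :: "(real ^ 'n::finite \<Rightarrow> real) \<Rightarrow> ennreal" where
  "BV_seminorm f = (SUP \<Phi>\<in>test_fields. ennreal (LINT x|lebesgue. f x * divergence \<Phi> x))"

definition BV_norm :: "(real ^ 'n::finite \<Rightarrow> real) \<Rightarrow> ennreal" where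
  "BV_norm f = (\<integral>\<^sup>+ x. ennreal \<bar>f x\<bar> \<partial>lebesgue) + BV_seminorm f"

definition BV :: "(real ^ 'n::finite \<Rightarrow> real) set" where
  "BV = {f \<in> borel_measurable lebesgue. BV_norm f < \<infinity>}"

(* Functions are extended-real valued from here on, since m_L is a supremum. *)
definition distr_fun :: "(real ^ 'n::finite \<Rightarrow> ereal) \<Rightarrow> real \<Rightarrow> ennreal" where
  "distr_fun f s = emeasure lebesgue {x. \<bar>f x\<bar> > ereal s}"

(* Powers with positive exponent only. *)
definition ennreal_powr :: "ennreal \<Rightarrow> real \<Rightarrow> ennreal" where
  "ennreal_powr a r = (if a = \<infinity> then \<infinity> else ennreal (enn2real a powr r))"

definition Lorentz_norm :: "real \<Rightarrow> (real ^ 'n::finite \<Rightarrow> ereal) \<Rightarrow> ennreal" where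
  "Lorentz_norm p f =
     ennreal p * (\<integral>\<^sup>+ s\<in>{0..}. ennreal_powr (distr_fun f s) (1 / p) \<partial>lborel)"

definition L_fun :: "(real ^ 'n::finite \<Rightarrow> ereal) \<Rightarrow> real \<Rightarrow> ereal" where
  "L_fun f t = Inf {ereal s | s. 0 \<le> s \<and> distr_fun f s < ennreal t}"

(* Nondegenerate closed cubes of arbitrary orientation. Replacing a cube by its closure
   can only increase m_L, and admitting all orientations can only increase it compared with
   cubes parallel to the axes. Any union of these cubes is Lebesgue measurable, hence so are
   the superlevel sets of m_L. *)
definition cubes :: "(real ^ 'n::finite) set set" where
  "cubes = {T ` cbox a (a + vec l) | (T :: real ^ 'n \<Rightarrow> real ^ 'n) a l.
     orthogonal_transformation T \<and> 0 < l}"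

definition m_L :: "real \<Rightarrow> real \<Rightarrow> (real ^ 'n::finite \<Rightarrow> real) \<Rightarrow> real ^ 'n \<Rightarrow> ereal" where
  "m_L \<alpha> \<gamma> f x =
     (SUP Q\<in>cubes. L_fun (\<lambda>y. ereal (f y * indicator Q y))
         (\<alpha> * measure lebesgue Q powr (1 - \<gamma> / real CARD('n))) * indicator Q x)"

end

(* For s >= 0 put E = {|f| > s} and e = |E|.

   Upper bound for m_L: if m_L f x > s, then x lies in a cube Q with |E \<inter> Q| >= \<alpha> |Q| powr (1 - \<gamma>/n).
   Since |E \<inter> Q| <= |Q|, such cubes have volume bounded below, which gives
   |Q| <= c |E \<inter> Q| e powr (\<gamma> / (n - 1 - \<gamma>)); the Vitali covering lemma then bounds |{m_L f > s}| by a
   multiple of e powr ((n - 1) / (n - 1 - \<gamma>)), and this is integrated in s.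

   Sobolev bound: testing f with \<Phi> y = (\<integral>t\<in>{0..1}. \<psi> (y - t v)) v/|v|, whose divergence is
   (\<psi> y - \<psi> (y - v)) / |v|, gives \<integral>|f (x + v) - f x| dx <= |v| |f|_BV.  By Tonelli the left side is the
   integral over s of |E \<triangle> (E - v)|.  Averaging over v in a cube of volume about 2 e shows that E has
   at least e / 2 change on average, an isoperimetric inequality at the scale e powr (1/n).  As this
   scale varies with s, |E \<triangle> (E - 2 v)| <= 2 |E \<triangle> (E - v)| is used to pass to small v, uniformly in s,
   and monotone convergence finishes the proof. *)
theory Submission
  imports Defs
begin

section \<open>The maximal operator\<close>

text \<open>For the maximal operator the exponents match at each level: with p = n / (n - 1 -
  \<gamma>) and p' = n / (n - 1), the power (n - 1) / (n - 1 - \<gamma>) times 1/p is 1/p'. So the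
  two integrands are comparable for every s.

  For the Sobolev bound, a function of bounded variation has no gradient to work with: |f|_BV is
  known only through smooth fields. Translation differences turn it into a statement about f itself,
  and all smoothing falls on \<psi>, never on f. It remains to have enough smooth \<psi> to recover
  an L^1 norm by duality; polynomials times exp (-1 / (R - |x|^2)) suffice, since their derivatives
  of all orders have the same shape.

  A single translation cannot give an isoperimetric inequality: a set stretched in the direction v
  hardly changes when moved by v. Hence the average over a cube of translations. In C_2 = n / (n -
  1) * 8 n the first factor is the normalization of the Lorentz norm, 8 collects the losses in the
  choice of the scale, and the last n bounds |v| on the unit cube.\<close>

lemma cube_radius_bounds:
  fixes Q :: "(real ^ 'n::finite) set"
  assumes "Q \<in> cubes"
  obtains c r where "0 < r" "Q \<subseteq> cball c r"
    "(5 * r) ^ CARD('n) * unit_ball_vol (real CARD('n))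
      \<le> (10 * real CARD('n)) ^ CARD('n) * measure lebesgue Q"
    "Q \<in> lmeasurable" "(r / (2 * real CARD('n))) ^ CARD('n) * unit_ball_vol (real CARD('n)) \<le> measure lebesgue Q"
proof -
  obtain T :: "real ^ 'n \<Rightarrow> real ^ 'n" and a l where T: "orthogonal_transformation T"
    and l: "0 < l" and Q: "Q = T ` cbox a (a + vec l)"
    using assms unfolding cubes_def by blast
  define n where "n = real CARD('n)"
  have n: "n \<ge> 1" unfolding n_def by (simp add: Suc_leI)
  have lin: "linear T" using T by (rule orthogonal_transformation_linear)
  have compQ: "compact Q" unfolding Q
    using lin by (intro compact_continuous_image linear_continuous_on linear_conv_bounded_linear[THEN iffD1]) auto
  then have Qm: "Q \<in> lmeasurable" by (simp add: lmeasurable_compact)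
  have sub: "Q \<subseteq> cball (T a) (n * l)"
  proof
    fix y assume "y \<in> Q"
    then obtain x where x: "x \<in> cbox a (a + vec l)" "y = T x" unfolding Q by auto
    have "dist (T a) (T x) = norm (x - a)"
      using T lin by (metis dist_commute dist_norm linear_diff orthogonal_transformation_norm)
    also have "\<dots> \<le> (\<Sum>i\<in>UNIV. \<bar>(x - a) $ i\<bar>)" by (rule norm_le_l1_cart)
    also have "\<dots> \<le> (\<Sum>i\<in>(UNIV::'n set). l)"
    proof (rule sum_mono)
      fix i
      have "a $ i \<le> x $ i" "x $ i \<le> a $ i + l" using x(1) by (auto simp: mem_box_cart)
      then show "\<bar>(x - a) $ i\<bar> \<le> l" by simp
    qed
    also have "\<dots> = n * l" by (simp add: n_def)
    finally show "y \<in> cball (T a) (n * l)" using x by auto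
  qed
  have "cball (T (a + vec (l/2))) (l/2) \<subseteq> Q"
  proof -
    have "cball (a + vec (l/2)) (l/2) \<subseteq> cbox a (a + vec l)"
    proof
      fix x assume "x \<in> cball (a + vec (l/2)) (l/2)"
      then have "norm (x - (a + vec (l/2))) \<le> l/2"
        by (simp add: dist_norm norm_minus_commute)
      then have "\<bar>(x - (a + vec (l/2))) $ i\<bar> \<le> l/2" for i
        by (rule norm_bound_component_le_cart)
      then have *: "\<bar>x $ i - (a $ i + l/2)\<bar> \<le> l/2" for i by (metis vector_add_component vector_minus_component vec_component)
      then show "x \<in> cbox a (a + vec l)"
        unfolding mem_box_cart
      proof (intro allI)
        fix i
        show "a $ i \<le> x $ i \<and> x $ i \<le> (a + vec l) $ i"
          using *[of i] unfolding abs_le_iff by (simp add: field_simps)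
      qed
    qed
    then show ?thesis unfolding Q
      using image_orthogonal_transformation_cball[OF T] by (metis image_mono)
  qed
  then have "measure lebesgue (cball (T (a + vec (l/2))) (l/2)) \<le> measure lebesgue Q"
    using Qm by (intro measure_mono_fmeasurable) auto
  then have low: "unit_ball_vol n * (l/2) ^ CARD('n) \<le> measure lebesgue Q"
    using l by (simp add: content_cball n_def)
  \<comment> \<open>The enclosing ball is centred at a vertex, with the l^1 bound
    \<open>n * l\<close> of the diagonal as radius; the inscribed ball has radius
    \<open>l/2\<close>. The ratio of \<open>5 * (n * l)\<close> to \<open>l/2\<close> is
    \<open>10 * n\<close>, the price of replacing a cube by the fivefold ball of the Vitali
    lemma.\<close>
  show ?thesis
  proof (rule that[of "n * l" "T a"])
    show "0 < n * l" using n l by simp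
    have "5 * (n * l) = (10 * n) * (l/2)" by simp
    then have "(5 * (n * l)) ^ CARD('n) * unit_ball_vol n = (10 * n) ^ CARD('n) * (unit_ball_vol n * (l/2) ^ CARD('n))"
      by (metis mult.assoc mult.commute power_mult_distrib)
    also have "\<dots> \<le> (10 * n) ^ CARD('n) * measure lebesgue Q"
      using low n by (intro mult_left_mono) auto
    finally show "(5 * (n * l)) ^ CARD('n) * unit_ball_vol (real CARD('n))
      \<le> (10 * real CARD('n)) ^ CARD('n) * measure lebesgue Q"
      by (simp only: n_def)
    show "(n * l / (2 * real CARD('n))) ^ CARD('n) * unit_ball_vol (real CARD('n)) \<le> measure lebesgue Q"
      using low n by (simp add: n_def mult.commute)
  qed (use sub Qm in auto)
qed

text \<open>A cube that satisfies the density condition has \<open>q \<ge> \<alpha> powr (n / \<gamma>)\<close>; without this lower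
  bound the exponents could not match.\<close>
lemma dense_cube_volume_bound:
  fixes q e a \<alpha> \<gamma> n :: real
  assumes "0 < \<gamma>" "\<gamma> < n - 1" "0 < \<alpha>" "0 < q"
    and dense: "\<alpha> * q powr (1 - \<gamma> / n) \<le> a" and "a \<le> q" "a \<le> e"
  shows "q \<le> \<alpha> powr (- 1 - (1 + \<gamma>) / (n - 1 - \<gamma>)) * a * e powr (\<gamma> / (n - 1 - \<gamma>))"
proof -
  define d where "d = n - 1 - \<gamma>"
  have d: "0 < d" "0 < n" using assms by (auto simp: d_def)
  have split: "q powr (1 - \<gamma> / n) * q powr (\<gamma> / n) = q"
    using assms by (simp flip: powr_add)
  have qpos: "0 < q powr (1 - \<gamma> / n)" using assms by simp
  have "\<alpha> * q powr (1 - \<gamma> / n) \<le> q powr (1 - \<gamma> / n) * q powr (\<gamma> / n)"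
    using assms split by simp
  then have \<alpha>q: "\<alpha> \<le> q powr (\<gamma> / n)" using qpos by (simp add: mult.commute)
  \<comment> \<open>The exponent splits as 1/d + \<gamma>/d. The first part of \<alpha> is traded
    for a power of q; the second part completes that power of q to the left side of the density
    condition, raised to \<gamma>/d.\<close>
  have "\<alpha> powr ((1 + \<gamma>) / d) * q powr (\<gamma> / n) = \<alpha> powr (1/d) * q powr (\<gamma>/n) * \<alpha> powr (\<gamma> / d)"
    using assms by (simp add: add_divide_distrib powr_add)
  also have "\<dots> \<le> (q powr (\<gamma>/n)) powr (1/d) * q powr (\<gamma>/n) * \<alpha> powr (\<gamma> / d)"
    using assms d \<alpha>q by (intro mult_right_mono powr_mono2) auto
  also have "\<dots> = q powr (\<gamma> / n / d + \<gamma> / n) * \<alpha> powr (\<gamma> / d)"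
    by (simp add: powr_powr powr_add)
  also have "\<gamma> / n / d + \<gamma> / n = (1 - \<gamma> / n) * (\<gamma> / d)"
    using d by (simp add: field_simps) (simp add: d_def algebra_simps)
  also have "q powr ((1 - \<gamma> / n) * (\<gamma> / d)) * \<alpha> powr (\<gamma> / d) = (\<alpha> * q powr (1 - \<gamma> / n)) powr (\<gamma> / d)"
    using assms by (simp add: powr_mult powr_powr mult.commute)
  also have "\<dots> \<le> e powr (\<gamma> / d)"
    using assms d by (intro powr_mono2) auto
  finally have "\<alpha> powr ((1 + \<gamma>) / d) * q powr (\<gamma> / n) \<le> e powr (\<gamma> / d)" .
  moreover have "\<alpha> powr (- (1 + \<gamma>) / d) = inverse (\<alpha> powr ((1 + \<gamma>) / d))"
    by (metis minus_divide_left powr_minus)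
  moreover have "0 < \<alpha> powr ((1 + \<gamma>) / d)" using assms by simp
  ultimately have 1: "q powr (\<gamma> / n) \<le> \<alpha> powr (- (1 + \<gamma>) / d) * e powr (\<gamma> / d)"
    by (metis divide_inverse inverse_eq_divide mult.commute pos_le_divide_eq)
  have 2: "q powr (1 - \<gamma> / n) \<le> \<alpha> powr (-1) * a"
    using dense assms by (simp add: powr_minus field_simps)
  have "a \<ge> 0" using dense qpos assms(3) by (smt (verit) mult_pos_pos)
  have "q \<le> (\<alpha> powr (-1) * a) * (\<alpha> powr (- (1 + \<gamma>) / d) * e powr (\<gamma> / d))"
    using mult_mono[OF 2 1] split \<open>a \<ge> 0\<close> by simp
  also have "\<dots> = \<alpha> powr (- 1 + - (1 + \<gamma>) / d) * a * e powr (\<gamma> / d)"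
    by (simp only: powr_add) simp
  finally show ?thesis by (metis d_def diff_conv_add_uminus minus_divide_left)
qed

text \<open>The Vitali lemma selects disjoint balls, so the pieces \<open>E \<inter> Q\<close> of
  the selected cubes are disjoint and their measures add up to at most |E|. This gives one factor
  |E|; the volume bound for each cube gives the power \<gamma> / (n - 1 - \<gamma>).\<close>

lemma dense_cubes_union_bound:
  fixes E S :: "(real ^ 'n::finite) set"
  assumes "0 < \<gamma>" "\<gamma> < real CARD('n) - 1" "0 < \<alpha>" and E: "E \<in> lmeasurable"
    and S: "\<And>x. x \<in> S \<Longrightarrow> \<exists>Q\<in>cubes. x \<in> Q \<and>
       \<alpha> * measure lebesgue Q powr (1 - \<gamma> / real CARD('n)) \<le> measure lebesgue (E \<inter> Q)"
  shows "emeasure lebesgue S \<le> ennreal ((10 * real CARD('n)) ^ CARD('n) *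
    \<alpha> powr (- 1 - (1 + \<gamma>) / (real CARD('n) - 1 - \<gamma>))
     * measure lebesgue E powr ((real CARD('n) - 1) / (real CARD('n) - 1 - \<gamma>)))"
proof -
  define n where "n = real CARD('n)"
  define c where "c = \<alpha> powr (- 1 - (1 + \<gamma>) / (n - 1 - \<gamma>))"
  define e where "e = measure lebesgue E"
  define K where "K = {Q \<in> cubes. \<alpha> * measure lebesgue Q powr (1 - \<gamma> / n) \<le> measure lebesgue (E \<inter> Q)}"
  define k where "k = c * e powr (\<gamma> / (n - 1 - \<gamma>))"
  have n1: "n \<ge> 1" unfolding n_def by (simp add: Suc_leI)
  define V where "V = unit_ball_vol n"
  have V: "V > 0" unfolding V_def n_def by simp
  have k0: "k \<ge> 0" by (simp add: k_def c_def)
  have "\<forall>Q\<in>(cubes :: (real^'n) set set). \<exists>p. 0 < snd p \<and> Q \<subseteq> cball (fst p) (snd p) \<and>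
      (5 * snd p) ^ CARD('n) * V \<le> (10 * n) ^ CARD('n) * measure lebesgue Q \<and>
      Q \<in> lmeasurable \<and> (snd p / (2 * n)) ^ CARD('n) * V \<le> measure lebesgue Q"
    unfolding V_def n_def by (metis cube_radius_bounds fst_conv snd_conv)
  then obtain p :: "(real ^ 'n) set \<Rightarrow> (real ^ 'n) \<times> real" where p: "\<And>Q. Q \<in> cubes \<Longrightarrow> 0 < snd (p Q) \<and> Q \<subseteq> cball (fst (p Q)) (snd (p Q)) \<and>
      (5 * snd (p Q)) ^ CARD('n) * V \<le> (10 * n) ^ CARD('n) * measure lebesgue Q \<and>
      Q \<in> lmeasurable \<and> (snd (p Q) / (2 * n)) ^ CARD('n) * V \<le> measure lebesgue Q"
    by (metis bchoice)
  let ?z = "\<lambda>Q. fst (p Q)" and ?r = "\<lambda>Q. snd (p Q)"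
  have Kq: "measure lebesgue Q \<le> k * measure lebesgue (E \<inter> Q)" if "Q \<in> K" for Q
  proof -
    have Qm: "Q \<in> lmeasurable" using p that by (auto simp: K_def)
    have "0 < (?r Q / (2 * n)) ^ CARD('n) * V" using p[of Q] that n1 V by (auto simp: K_def)
    then have q: "0 < measure lebesgue Q" using p[of Q] that by (auto simp: K_def)
    have "measure lebesgue Q \<le> c * measure lebesgue (E \<inter> Q) * e powr (\<gamma> / (n - 1 - \<gamma>))"
      unfolding c_def
    proof (rule dense_cube_volume_bound)
      show "\<alpha> * measure lebesgue Q powr (1 - \<gamma> / n) \<le> measure lebesgue (E \<inter> Q)"
        using that by (simp add: K_def)
    qed (use assms n_def q Qm E in \<open>auto simp: e_def intro!: measure_mono_fmeasurable\<close>)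
    then show ?thesis by (simp add: k_def mult_ac)
  qed
  \<comment> \<open>The covering lemma requires bounded radii, which |Q| <= k e supplies. The
    maximum with 1 gives M <= M ^ n and so avoids an n-th root.\<close>
  define M where "M = max 1 (k * e / V)"
  have rb: "0 < ?r Q \<and> ?r Q \<le> 2 * n * M" if "Q \<in> K" for Q
  proof -
    have Q: "Q \<in> cubes" "Q \<in> lmeasurable" using p that by (auto simp: K_def)
    have "measure lebesgue (E \<inter> Q) \<le> e"
      unfolding e_def using E Q by (intro measure_mono_fmeasurable) auto
    then have "measure lebesgue Q \<le> k * e"
      using Kq[OF that] k0 by (meson mult_left_mono order_trans)
    then have "(?r Q / (2 * n)) ^ CARD('n) \<le> k * e / V"
      using p[OF Q(1)] V by (simp add: pos_le_divide_eq)
    also have "\<dots> \<le> M" by (simp add: M_def)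
    also have "M \<le> M ^ CARD('n)"
      by (rule self_le_power) (auto simp: M_def)
    finally have "?r Q / (2 * n) \<le> M"
      by (rule power_le_imp_le_base[where n="CARD('n) - 1", simplified]) (simp add: M_def)
    then show ?thesis using n1 p[OF Q(1)] by (simp add: field_simps)
  qed
  have "S \<subseteq> (\<Union>Q\<in>K. cball (?z Q) (?r Q))"
  proof
    fix x assume "x \<in> S"
    then obtain Q where "Q \<in> K" "x \<in> Q" using S unfolding K_def n_def by blast
    then show "x \<in> (\<Union>Q\<in>K. cball (?z Q) (?r Q))" using p[of Q] by (auto simp: K_def simp del: mem_cball)
  qed
  then obtain C where C: "countable C" "C \<subseteq> K"
     "pairwise (\<lambda>i j. disjnt (cball (?z i) (?r i)) (cball (?z j) (?r j))) C"
     "S \<subseteq> (\<Union>i\<in>C. cball (?z i) (5 * ?r i))"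
    using rb by (rule Vitali_covering_lemma_cballs)
  have CQ: "Q \<in> cubes" "Q \<in> lmeasurable" if "Q \<in> C" for Q using that C p by (auto simp: K_def)
  have disj: "disjoint_family_on (\<lambda>Q. E \<inter> Q) C"
    unfolding disjoint_family_on_def
  proof (intro ballI impI)
    fix A B assume AB: "A \<in> C" "B \<in> C" "A \<noteq> B"
    then have "disjnt (cball (?z A) (?r A)) (cball (?z B) (?r B))"
      using C(3) by (auto simp: pairwise_def)
    moreover have "A \<subseteq> cball (?z A) (?r A)" "B \<subseteq> cball (?z B) (?r B)"
      using p CQ AB by auto
    ultimately show "E \<inter> A \<inter> (E \<inter> B) = {}" by (auto simp: disjnt_def)
  qed
  have ball: "emeasure lebesgue (cball (?z Q) (5 * ?r Q))
      \<le> ennreal ((10 * n) ^ CARD('n) * k) * emeasure lebesgue (E \<inter> Q)" if "Q \<in> C" for Q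
  proof -
    have "emeasure lebesgue (cball (?z Q) (5 * ?r Q)) = ennreal ((5 * ?r Q) ^ CARD('n) * V)"
      using p[OF CQ(1)[OF that]] emeasure_eq_measure2[of "cball (?z Q) (5 * ?r Q)" lebesgue]
      by (simp add: content_cball V_def n_def mult.commute)
    also have "\<dots> \<le> ennreal ((10 * n) ^ CARD('n) * measure lebesgue Q)"
      using p[OF CQ(1)[OF that]] by (intro ennreal_leI) auto
    also have "\<dots> \<le> ennreal ((10 * n) ^ CARD('n) * (k * measure lebesgue (E \<inter> Q)))"
      using Kq[of Q] that C n1 by (intro ennreal_leI mult_left_mono) auto
    also have "\<dots> = ennreal ((10 * n) ^ CARD('n) * k) * emeasure lebesgue (E \<inter> Q)"
      using CQ[OF that] E k0 n1 emeasure_eq_measure2[of "E \<inter> Q" lebesgue]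
      by (simp add: ennreal_mult fmeasurable.Int mult.assoc)
    finally show ?thesis .
  qed
  have "emeasure lebesgue S \<le> emeasure lebesgue (\<Union>i\<in>C. cball (?z i) (5 * ?r i))"
    using C by (intro emeasure_mono sets.countable_UN') auto
  \<comment> \<open>Countable subadditivity, with the sum written as an integral over counting
    measure because \<open>C\<close> is a countable set and not a sequence.\<close>
  also have "\<dots> \<le> (\<integral>\<^sup>+Q. emeasure lebesgue (cball (?z Q) (5 * ?r Q)) \<partial>count_space C)"
  proof -
    have "emeasure lebesgue (\<Union>i\<in>C. cball (?z i) (5 * ?r i))
      = (\<integral>\<^sup>+x. indicator (\<Union>i\<in>C. cball (?z i) (5 * ?r i)) x \<partial>lebesgue)"
      using C by (intro nn_integral_indicator[symmetric] sets.countable_UN') auto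
    also have "\<dots> \<le> (\<integral>\<^sup>+x. \<integral>\<^sup>+Q. indicator (cball (?z Q) (5 * ?r Q)) x \<partial>count_space C \<partial>lebesgue)"
    proof (rule nn_integral_mono)
      fix x
      show "indicator (\<Union>i\<in>C. cball (?z i) (5 * ?r i)) x \<le> (\<integral>\<^sup>+Q. indicator (cball (?z Q) (5 * ?r Q)) x \<partial>count_space C)"
      proof (cases "x \<in> (\<Union>i\<in>C. cball (?z i) (5 * ?r i))")
        case True
        then obtain Q where Q: "Q \<in> C" "x \<in> cball (?z Q) (5 * ?r Q)" by blast
        show ?thesis
          using nn_integral_ge_point[OF Q(1), of "\<lambda>Q. indicator (cball (?z Q) (5 * ?r Q)) x"] Q True
          by (simp del: mem_cball)
      qed simp
    qed
    also have "\<dots> = (\<integral>\<^sup>+Q. emeasure lebesgue (cball (?z Q) (5 * ?r Q)) \<partial>count_space C)"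
      using C(1) by (subst nn_integral_count_space_nn_integral)
        (auto intro!: borel_measurable_indicator)
    finally show ?thesis .
  qed
  also have "\<dots> \<le> (\<integral>\<^sup>+Q. ennreal ((10 * n) ^ CARD('n) * k) * emeasure lebesgue (E \<inter> Q) \<partial>count_space C)"
    using ball by (intro nn_integral_mono) auto
  also have "\<dots> = ennreal ((10 * n) ^ CARD('n) * k) * (\<integral>\<^sup>+Q. emeasure lebesgue (E \<inter> Q) \<partial>count_space C)"
    by (rule nn_integral_cmult) simp
  also have "(\<integral>\<^sup>+Q. emeasure lebesgue (E \<inter> Q) \<partial>count_space C) = emeasure lebesgue (\<Union>Q\<in>C. E \<inter> Q)"
    using CQ E C disj by (intro emeasure_UN_countable[symmetric]) auto
  also have "\<dots> \<le> emeasure lebesgue E"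
    using E by (intro emeasure_mono) auto
  also have "emeasure lebesgue E = ennreal e"
    unfolding e_def using E by (rule emeasure_eq_measure2)
  also have "ennreal ((10 * n) ^ CARD('n) * k) * ennreal e = ennreal ((10 * n) ^ CARD('n) * c * e powr ((n - 1) / (n - 1 - \<gamma>)))"
  proof -
    have "(n - 1) / (n - 1 - \<gamma>) = 1 + \<gamma> / (n - 1 - \<gamma>)"
      using assms by (simp add: n_def field_simps)
    then have "e powr ((n - 1) / (n - 1 - \<gamma>)) = e * e powr (\<gamma> / (n - 1 - \<gamma>))"
      by (cases "e = 0") (auto simp: e_def powr_add)
    then have "(10 * n) ^ CARD('n) * c * e powr ((n - 1) / (n - 1 - \<gamma>)) = (10 * n) ^ CARD('n) * k * e"
      by (simp add: k_def)
    moreover have "0 \<le> (10 * n) ^ CARD('n) * k" "0 \<le> e" using n1 k0 by (auto simp: e_def)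
    ultimately show ?thesis
      by (simp only: ennreal_mult[symmetric])
  qed
  finally show ?thesis by (simp add: n_def c_def e_def mult_left_mono)
qed

text \<open>If the distribution function of f on Q were below the threshold at s, then s would be
  admissible in the infimum \<open>L_fun\<close>, which would be at most s. A cube that misses x
  contributes 0 and cannot exceed s.\<close>

lemma dense_cube_if_less_m_L:
  fixes f :: "real ^ 'n::finite \<Rightarrow> real"
  assumes "0 \<le> s" "ereal s < \<bar>m_L \<alpha> \<gamma> f x\<bar>"
  shows "\<exists>Q\<in>cubes. x \<in> Q \<and> ennreal (\<alpha> * measure lebesgue Q powr (1 - \<gamma> / real CARD('n)))
    \<le> emeasure lebesgue ({y. s < \<bar>f y\<bar>} \<inter> Q)"
proof -
  have L0: "0 \<le> L_fun g t" for g :: "real ^ 'n \<Rightarrow> ereal" and t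
    unfolding L_fun_def by (rule Inf_greatest) auto
  \<comment> \<open>One cube has to be exhibited: a supremum over an empty family would be minus
    infinity. Nonnegativity then removes the absolute value.\<close>
  have "cbox 0 (0 + vec 1) \<in> (cubes :: (real ^ 'n) set set)"
    unfolding cubes_def
    by (rule CollectI, rule exI[of _ id], rule exI[of _ 0], rule exI[of _ 1]) (simp add: orthogonal_transformation_id id_def)
  then have "0 \<le> m_L \<alpha> \<gamma> f x"
    unfolding m_L_def by (rule SUP_upper2) (simp add: L0)
  then have "ereal s < m_L \<alpha> \<gamma> f x" using assms by simp
  then obtain Q where Q: "Q \<in> cubes" and less: "ereal s < L_fun (\<lambda>y. ereal (f y * indicator Q y))
         (\<alpha> * measure lebesgue Q powr (1 - \<gamma> / real CARD('n))) * indicator Q x"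
    unfolding m_L_def less_SUP_iff by blast
  have xQ: "x \<in> Q" using less assms(1) by (cases "x \<in> Q") auto
  have "\<not> distr_fun (\<lambda>y. ereal (f y * indicator Q y)) s < ennreal (\<alpha> * measure lebesgue Q powr (1 - \<gamma> / real CARD('n)))"
  proof
    assume "distr_fun (\<lambda>y. ereal (f y * indicator Q y)) s < ennreal (\<alpha> * measure lebesgue Q powr (1 - \<gamma> / real CARD('n)))"
    then have "L_fun (\<lambda>y. ereal (f y * indicator Q y)) (\<alpha> * measure lebesgue Q powr (1 - \<gamma> / real CARD('n))) \<le> ereal s"
      unfolding L_fun_def using assms(1) by (intro Inf_lower) auto
    then show False using less xQ by simp
  qed
  moreover have "{y. \<bar>ereal (f y * indicator Q y)\<bar> > ereal s} = {y. s < \<bar>f y\<bar>} \<inter> Q"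
    using assms(1) by (auto simp: indicator_def)
  ultimately show ?thesis using Q xQ by (auto simp: distr_fun_def not_less)
qed

section \<open>From bounds at each level to Lorentz norms\<close>

lemma ennreal_powr_mono: "a \<le> b \<Longrightarrow> 0 \<le> r \<Longrightarrow> ennreal_powr a r \<le> ennreal_powr b r"
  by (auto simp: ennreal_powr_def top_unique less_top enn2real_mono intro!: ennreal_leI powr_mono2)

lemma borel_measurable_ennreal_powr [measurable]: "(\<lambda>a. ennreal_powr a r) \<in> borel_measurable borel"
  unfolding ennreal_powr_def by measurable

lemma ennreal_powr_ennreal: "0 \<le> x \<Longrightarrow> ennreal_powr (ennreal x) r = ennreal (x powr r)"
  by (simp add: ennreal_powr_def)

lemma distr_fun_antimono:
  assumes "f \<in> borel_measurable lebesgue" "s \<le> t"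
  shows "distr_fun f t \<le> distr_fun f s"
  unfolding distr_fun_def
proof (rule emeasure_mono)
  have "{x \<in> space lebesgue. ereal s < \<bar>f x\<bar>} \<in> sets lebesgue"
    using assms(1) by measurable
  then show "{x. ereal s < \<bar>f x\<bar>} \<in> sets lebesgue" by simp
  show "{x. ereal t < \<bar>f x\<bar>} \<subseteq> {x. ereal s < \<bar>f x\<bar>}"
    using assms(2) by (auto intro: le_less_trans[of "ereal s" "ereal t"])
qed

lemma borel_measurable_distr_fun:
  assumes "f \<in> borel_measurable lebesgue"
  shows "distr_fun f \<in> borel_measurable borel"
proof (rule borel_measurableI_greater)
  fix y
  have "is_interval {x. y < distr_fun f x}"
    unfolding is_interval_1 using distr_fun_antimono[OF assms] by (auto intro: less_le_trans)
  then show "{x \<in> space borel. y < distr_fun f x} \<in> sets borel"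
    by (simp add: real_interval_borel_measurable)
qed

lemma Lorentz_norm_m_L_le:
  fixes \<gamma> \<alpha> :: real
  assumes "0 < \<gamma>" "\<gamma> < real CARD('n::finite) - 1" "0 < \<alpha>"
  obtains C where "0 < C"
    "\<And>f :: real ^ 'n \<Rightarrow> real. f \<in> borel_measurable lebesgue \<Longrightarrow>
      Lorentz_norm (real CARD('n) / (real CARD('n) - (1 + \<gamma>))) (m_L \<alpha> \<gamma> f)
        \<le> ennreal C * Lorentz_norm (real CARD('n) / (real CARD('n) - 1)) (\<lambda>x. ereal (f x))"
proof -
  define n where "n = real CARD('n)"
  define c where "c = (10 * n) ^ CARD('n) * \<alpha> powr (- 1 - (1 + \<gamma>) / (n - 1 - \<gamma>))"
  define p where "p = n / (n - (1 + \<gamma>))"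
  define p' where "p' = n / (n - 1)"
  have n: "0 < n" "\<gamma> < n - 1" using assms by (auto simp: n_def)
  have c: "0 < c" using n assms by (simp add: c_def)
  have p: "0 < p" "0 < p'" using n assms by (auto simp: p_def p'_def)
  have pw: "ennreal_powr (distr_fun (m_L \<alpha> \<gamma> f) s) (1 / p) \<le>
      ennreal (c powr (1 / p)) * ennreal_powr (distr_fun (\<lambda>x. ereal (f x)) s) (1 / p')"
    if f: "f \<in> borel_measurable lebesgue" and s: "0 \<le> s" for f :: "real ^ 'n \<Rightarrow> real" and s
  proof (cases "distr_fun (\<lambda>x. ereal (f x)) s = \<infinity>")
    \<comment> \<open>The right side is infinite, because \<open>c powr (1 / p)\<close> is
      positive.\<close>
    case True
    then show ?thesis using c by (simp add: ennreal_powr_def ennreal_mult_top)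
  next
    case False
    define E where "E = {y. s < \<bar>f y\<bar>}"
    have "{y \<in> space lebesgue. s < \<bar>f y\<bar>} \<in> sets lebesgue"
      using f by measurable
    then have "E \<in> sets lebesgue" by (simp add: E_def)
    then have E: "E \<in> lmeasurable" using False
      by (simp add: fmeasurable_def distr_fun_def E_def less_top)
    have dE: "distr_fun (\<lambda>x. ereal (f x)) s = ennreal (measure lebesgue E)"
      using emeasure_eq_measure2[OF E] by (simp add: distr_fun_def E_def)
    have "distr_fun (m_L \<alpha> \<gamma> f) s \<le> ennreal (c * measure lebesgue E powr ((n - 1) / (n - 1 - \<gamma>)))"
      unfolding distr_fun_def c_def n_def
    proof (rule dense_cubes_union_bound[OF assms E])
      fix x assume "x \<in> {x. ereal s < \<bar>m_L \<alpha> \<gamma> f x\<bar>}"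
      then obtain Q where Q: "Q \<in> cubes" "x \<in> Q" "ennreal (\<alpha> * measure lebesgue Q powr (1 - \<gamma> / real CARD('n)))
           \<le> emeasure lebesgue (E \<inter> Q)"
        using dense_cube_if_less_m_L[OF s] unfolding E_def by blast
      then have "Q \<in> lmeasurable" by (metis cube_radius_bounds)
      then have "E \<inter> Q \<in> lmeasurable" using E by (simp add: fmeasurable.Int)
      then have "\<alpha> * measure lebesgue Q powr (1 - \<gamma> / real CARD('n)) \<le> measure lebesgue (E \<inter> Q)"
        using Q(3) by (simp add: emeasure_eq_measure2)
      then show "\<exists>Q\<in>cubes. x \<in> Q \<and> \<alpha> * measure lebesgue Q powr (1 - \<gamma> / real CARD('n)) \<le> measure lebesgue (E \<inter> Q)"
        using Q by blast
    qed
    then have "ennreal_powr (distr_fun (m_L \<alpha> \<gamma> f) s) (1 / p)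
       \<le> ennreal ((c * measure lebesgue E powr ((n - 1) / (n - 1 - \<gamma>))) powr (1 / p))"
      using p c by (subst ennreal_powr_ennreal[symmetric]) (auto intro: ennreal_powr_mono)
    also have "(c * measure lebesgue E powr ((n - 1) / (n - 1 - \<gamma>))) powr (1 / p)
       = c powr (1 / p) * measure lebesgue E powr (1 / p')"
    proof -
      have "(n - 1) / (n - 1 - \<gamma>) * (1 / p) = 1 / p'"
        using n by (simp add: p_def p'_def diff_diff_eq)
      then show ?thesis using c by (simp add: powr_mult powr_powr)
    qed
    finally show ?thesis using c by (simp add: dE ennreal_powr_ennreal ennreal_mult)
  qed
  show ?thesis
  \<comment> \<open>The quotient \<open>p / p'\<close> exchanges the leading factors of the two
    Lorentz norms; \<open>c powr (1 / p)\<close> is the constant at each level.\<close>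
  proof (rule that[of "p * c powr (1 / p) / p'"])
    show "0 < p * c powr (1 / p) / p'" using p c by simp
    fix f :: "real ^ 'n \<Rightarrow> real" assume f: "f \<in> borel_measurable lebesgue"
    then have fe: "(\<lambda>x. ereal (f x)) \<in> borel_measurable lebesgue" by measurable
    note [measurable] = borel_measurable_distr_fun[OF fe]
    have "Lorentz_norm p (m_L \<alpha> \<gamma> f) \<le> ennreal p *
       (\<integral>\<^sup>+s\<in>{0..}. ennreal (c powr (1 / p)) * ennreal_powr (distr_fun (\<lambda>x. ereal (f x)) s) (1 / p') \<partial>lborel)"
      unfolding Lorentz_norm_def using pw[OF f]
      by (intro mult_left_mono nn_integral_mono) (auto simp: indicator_def)
    also have "\<dots> = ennreal p * (ennreal (c powr (1 / p)) *
       (\<integral>\<^sup>+s\<in>{0..}. ennreal_powr (distr_fun (\<lambda>x. ereal (f x)) s) (1 / p') \<partial>lborel))"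
      by (simp add: nn_integral_cmult mult.assoc)
    also have "\<dots> = ennreal (p * c powr (1 / p) / p') * Lorentz_norm p' (\<lambda>x. ereal (f x))"
    proof -
      have "ennreal p * ennreal (c powr (1 / p)) = ennreal (p * c powr (1 / p) / p') * ennreal p'"
        using p by (simp add: ennreal_mult[symmetric])
      then show ?thesis unfolding Lorentz_norm_def mult.assoc[symmetric] by (rule arg_cong)
    qed
    finally show "Lorentz_norm (real CARD('n) / (real CARD('n) - (1 + \<gamma>))) (m_L \<alpha> \<gamma> f)
        \<le> ennreal (p * c powr (1 / p) / p') * Lorentz_norm (real CARD('n) / (real CARD('n) - 1)) (\<lambda>x. ereal (f x))"
      by (simp add: p_def p'_def n_def)
  qed
qed

section \<open>Translations of superlevel sets\<close>

text \<open>With E = {s < f} this is |E \<triangle> (E - v)|. Written as an integral it is jointly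
  measurable in v and s, which Tonelli requires.\<close>

definition level_diff :: "('a::euclidean_space \<Rightarrow> real) \<Rightarrow> 'a \<Rightarrow> real \<Rightarrow> ennreal" where
  "level_diff f v s = (\<integral>\<^sup>+x. (if (s < f (x + v)) \<noteq> (s < f x) then 1 else 0) \<partial>lborel)"

lemma measurable_level_diff [measurable]:
  fixes f :: "'a::euclidean_space \<Rightarrow> real"
  assumes [measurable]: "f \<in> borel_measurable borel" "g \<in> borel_measurable M" "h \<in> borel_measurable M"
  shows "(\<lambda>u. level_diff f (g u) (h u)) \<in> borel_measurable M"
  unfolding level_diff_def by measurable

lemma nn_integral_lborel_translate:
  fixes g :: "'a::euclidean_space \<Rightarrow> ennreal"
  assumes [measurable]: "g \<in> borel_measurable borel"
  shows "(\<integral>\<^sup>+x. g (x + v) \<partial>lborel) = (\<integral>\<^sup>+x. g x \<partial>lborel)"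
proof -
  have "(\<integral>\<^sup>+x. g x \<partial>lborel) = (\<integral>\<^sup>+x. g x \<partial>distr lborel borel ((+) v))"
    by (simp add: lborel_distr_plus)
  also have "\<dots> = (\<integral>\<^sup>+x. g (x + v) \<partial>lborel)"
    by (subst nn_integral_distr) (auto simp: add.commute)
  finally show ?thesis by simp
qed

lemma nn_integral_lborel_affine:
  fixes g :: "'a::euclidean_space \<Rightarrow> ennreal"
  assumes [measurable]: "g \<in> borel_measurable borel" and "r > 0"
  shows "(\<integral>\<^sup>+x. g x \<partial>lborel) = ennreal (r ^ DIM('a)) * (\<integral>\<^sup>+u. g (t + r *\<^sub>R u) \<partial>lborel)"
  using assms(2)
  by (subst lborel_affine[of r t]) (auto simp: nn_integral_density nn_integral_distr nn_integral_cmult)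

text \<open>For fixed x, the levels that separate f x from f (x + v) fill a half-open interval
  between these values, whose length is the absolute difference. As f is nonnegative, this interval
  lies in \<open>{0..}\<close>.\<close>

lemma coarea_level_diff:
  fixes f :: "'a::euclidean_space \<Rightarrow> real"
  assumes [measurable]: "f \<in> borel_measurable borel" and nonneg: "\<And>x. 0 \<le> f x"
  shows "(\<integral>\<^sup>+s\<in>{0..}. level_diff f v s \<partial>lborel) = (\<integral>\<^sup>+x. ennreal \<bar>f (x + v) - f x\<bar> \<partial>lborel)"
proof -
  let ?j = "\<lambda>x s. (if (s < f (x + v)) \<noteq> (s < f x) then 1 else 0) * indicator {0..} s :: ennreal"
  have "(\<integral>\<^sup>+s\<in>{0..}. level_diff f v s \<partial>lborel) = (\<integral>\<^sup>+s. \<integral>\<^sup>+x. ?j x s \<partial>lborel \<partial>lborel)"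
    unfolding level_diff_def by (subst nn_integral_multc[symmetric]) auto
  also have "\<dots> = (\<integral>\<^sup>+x. \<integral>\<^sup>+s. ?j x s \<partial>lborel \<partial>lborel)"
    by (rule lborel_pair.Fubini') measurable
  also have "\<dots> = (\<integral>\<^sup>+x. ennreal \<bar>f (x + v) - f x\<bar> \<partial>lborel)"
  proof (rule nn_integral_cong)
    fix x
    have "?j x s = indicator {min (f x) (f (x + v))..<max (f x) (f (x + v))} s" for s
      using nonneg[of x] nonneg[of "x + v"] by (auto simp: indicator_def)
    then have "(\<integral>\<^sup>+s. ?j x s \<partial>lborel) = emeasure lborel {min (f x) (f (x + v))..<max (f x) (f (x + v))}"
      by simp
    also have "\<dots> = ennreal \<bar>f (x + v) - f x\<bar>"
      by (simp add: max_def min_def abs_real_def)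
    finally show "(\<integral>\<^sup>+s. ?j x s \<partial>lborel) = ennreal \<bar>f (x + v) - f x\<bar>" .
  qed
  finally show ?thesis .
qed

text \<open>E \<triangle> (E - 2 v) is contained in the union of E \<triangle> (E - v) and its
  translate by -v, which have the same measure.\<close>

lemma level_diff_double:
  fixes f :: "'a::euclidean_space \<Rightarrow> real"
  assumes [measurable]: "f \<in> borel_measurable borel"
  shows "level_diff f (2 *\<^sub>R v) s \<le> 2 * level_diff f v s"
proof -
  let ?j = "\<lambda>x. (if (s < f (x + v)) \<noteq> (s < f x) then 1 else 0) :: ennreal"
  have "level_diff f (2 *\<^sub>R v) s \<le> (\<integral>\<^sup>+x. ?j (x + v) + ?j x \<partial>lborel)"
    unfolding level_diff_def by (intro nn_integral_mono) (auto simp: scaleR_2 add.assoc)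
  also have "\<dots> = (\<integral>\<^sup>+x. ?j (x + v) \<partial>lborel) + (\<integral>\<^sup>+x. ?j x \<partial>lborel)"
    by (rule nn_integral_add) measurable
  also have "(\<integral>\<^sup>+x. ?j (x + v) \<partial>lborel) = (\<integral>\<^sup>+x. ?j x \<partial>lborel)"
    by (rule nn_integral_lborel_translate) measurable
  finally show ?thesis by (simp add: level_diff_def mult_2)
qed

lemma level_diff_power2:
  fixes f :: "'a::euclidean_space \<Rightarrow> real"
  assumes [measurable]: "f \<in> borel_measurable borel"
  shows "level_diff f (2 ^ m *\<^sub>R v) s \<le> 2 ^ m * level_diff f v s"
proof (induction m)
  case (Suc m)
  have "level_diff f (2 ^ Suc m *\<^sub>R v) s \<le> 2 * level_diff f (2 ^ m *\<^sub>R v) s"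
    using level_diff_double[OF assms, of "2 ^ m *\<^sub>R v" s] by simp
  also have "\<dots> \<le> 2 * (2 ^ m * level_diff f v s)"
    by (intro mult_left_mono Suc) auto
  finally show ?case by (simp add: mult.assoc)
qed simp

text \<open>The average over translations \<open>v\<close> of \<open>|E \<inter> (E - v)|\<close> over a cube of side \<open>r\<close> is at most
  \<open>|E|\<^sup>2 / r\<^sup>n\<close>, so \<open>E\<close> must change noticeably under translations of size \<open>|E| powr (1/n)\<close>.\<close>
lemma level_diff_average_lower_bound:
  fixes f :: "'a::euclidean_space \<Rightarrow> real"
  assumes [measurable]: "f \<in> borel_measurable borel"
    and e: "emeasure lborel {x. s < f x} = ennreal e" "0 \<le> e"
    and r: "0 < r" "2 * e \<le> r ^ DIM('a)"
  shows "ennreal (e / 2) \<le> (\<integral>\<^sup>+u\<in>cbox 0 One. level_diff f (r *\<^sub>R u) s \<partial>lborel)"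
proof -
  let ?C = "indicator (cbox 0 One) :: 'a \<Rightarrow> ennreal"
  let ?E = "\<lambda>x. (if s < f x then 1 else 0) :: ennreal"
  have intE: "(\<integral>\<^sup>+x. ?E x \<partial>lborel) = ennreal e"
  proof -
    have "(\<integral>\<^sup>+x. ?E x \<partial>lborel) = (\<integral>\<^sup>+x. indicator {x. s < f x} x \<partial>lborel)"
      by (intro nn_integral_cong) auto
    also have "\<dots> = emeasure lborel {x. s < f x}" by (rule nn_integral_indicator) measurable
    finally show ?thesis using e by simp
  qed
  \<comment> \<open>The overlap |E \<inter> (E - r u)| is integrated over all u and not only over
    the cube: Tonelli and a change of variables then give exactly e^2 / r^n, which bounds the part
    in the cube.\<close>
  define I where "I = (\<integral>\<^sup>+u. \<integral>\<^sup>+x. ?E x * ?E (x + r *\<^sub>R u) \<partial>lborel \<partial>lborel)"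
  have "I = (\<integral>\<^sup>+x. \<integral>\<^sup>+u. ?E x * ?E (x + r *\<^sub>R u) \<partial>lborel \<partial>lborel)"
    unfolding I_def by (rule lborel_pair.Fubini') measurable
  also have "\<dots> = (\<integral>\<^sup>+x. ?E x * (\<integral>\<^sup>+u. ?E (x + r *\<^sub>R u) \<partial>lborel) \<partial>lborel)"
    by (intro nn_integral_cong nn_integral_cmult) measurable
  finally have "ennreal (r ^ DIM('a)) * I = (\<integral>\<^sup>+x. ?E x * (ennreal (r ^ DIM('a)) * (\<integral>\<^sup>+u. ?E (x + r *\<^sub>R u) \<partial>lborel)) \<partial>lborel)"
    by (simp add: nn_integral_cmult[symmetric] mult.left_commute)
  also have "\<dots> = (\<integral>\<^sup>+x. ?E x * ennreal e \<partial>lborel)"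
    using r(1) by (simp add: nn_integral_lborel_affine[symmetric, of ?E] intE)
  also have "\<dots> = ennreal e * ennreal e"
    using intE by (simp add: nn_integral_multc)
  finally have I: "ennreal (r ^ DIM('a)) * I = ennreal (e * e)" using e by (simp add: ennreal_mult)
  have "I \<le> ennreal (e / 2)"
  proof -
    have "I = ennreal (e * e) / ennreal (r ^ DIM('a))"
      using I r by (metis ennreal_mult_divide_eq ennreal_neq_top ennreal_eq_0_iff linorder_not_le mult.commute zero_less_power)
    also have "\<dots> = ennreal (e * e / r ^ DIM('a))"
      using r e by (simp add: divide_ennreal)
    also have "\<dots> \<le> ennreal (e / 2)"
    proof (rule ennreal_leI)
      have "e * (2 * e) \<le> e * r ^ DIM('a)" using r e by (intro mult_left_mono) auto
      then show "e * e / r ^ DIM('a) \<le> e / 2" using r by (simp add: field_simps)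
    qed
    finally show ?thesis .
  qed
  have "ennreal e = (\<integral>\<^sup>+u. ennreal e * ?C u \<partial>lborel)"
    by (subst nn_integral_cmult_indicator) (auto simp: emeasure_lborel_cbox_eq)
  also have "\<dots> = (\<integral>\<^sup>+u. (\<integral>\<^sup>+x. ?E x \<partial>lborel) * ?C u \<partial>lborel)" by (simp add: intE)
  also have "\<dots> \<le> (\<integral>\<^sup>+u. level_diff f (r *\<^sub>R u) s * ?C u + (\<integral>\<^sup>+x. ?E x * ?E (x + r *\<^sub>R u) \<partial>lborel) \<partial>lborel)"
  proof (intro nn_integral_mono)
    fix u
    have "(\<integral>\<^sup>+x. ?E x \<partial>lborel) \<le> (\<integral>\<^sup>+x. (if (s < f (x + r *\<^sub>R u)) \<noteq> (s < f x) then 1 else 0) + ?E x * ?E (x + r *\<^sub>R u) \<partial>lborel)"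
      by (intro nn_integral_mono) auto
    also have "\<dots> = level_diff f (r *\<^sub>R u) s + (\<integral>\<^sup>+x. ?E x * ?E (x + r *\<^sub>R u) \<partial>lborel)"
      unfolding level_diff_def by (rule nn_integral_add) measurable
    finally show "(\<integral>\<^sup>+x. ?E x \<partial>lborel) * ?C u \<le> level_diff f (r *\<^sub>R u) s * ?C u + (\<integral>\<^sup>+x. ?E x * ?E (x + r *\<^sub>R u) \<partial>lborel)"
      by (auto simp: indicator_def)
  qed
  also have "\<dots> = (\<integral>\<^sup>+u\<in>cbox 0 One. level_diff f (r *\<^sub>R u) s \<partial>lborel) + I"
    unfolding I_def by (rule nn_integral_add) measurable
  also have "\<dots> \<le> (\<integral>\<^sup>+u\<in>cbox 0 One. level_diff f (r *\<^sub>R u) s \<partial>lborel) + ennreal (e / 2)"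
    using \<open>I \<le> _\<close> by (intro add_left_mono)
  finally have "ennreal e \<le> \<dots>" .
  then have "ennreal e - ennreal (e / 2) \<le> (\<integral>\<^sup>+u\<in>cbox 0 One. level_diff f (r *\<^sub>R u) s \<partial>lborel)"
    by (simp add: ennreal_minus_le_iff add.commute)
  moreover have "ennreal e - ennreal (e / 2) = ennreal (e / 2)"
    using e by (simp add: ennreal_minus)
  ultimately show ?thesis by simp
qed

section \<open>Isoperimetric inequality through dyadic difference quotients\<close>

lemma ex_dyadic_between:
  fixes \<rho> :: real
  assumes "0 < \<rho>"
  obtains m K :: nat where "\<rho> \<le> 2 ^ m / 2 ^ K" "2 ^ m / 2 ^ K \<le> 2 * \<rho>"
proof -
  \<comment> \<open>The exponent m counts doublings of a translation of size 1 / 2^K, so it must be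
    natural. Making 2^K \<rho> exceed 1 ensures this; it also settles the case m = 0 below.\<close>
  obtain K :: nat where K: "1 / \<rho> < 2 ^ K" using real_arch_pow[of 2 "1 / \<rho>"] by auto
  define m where "m = (LEAST m. 2 ^ K * \<rho> \<le> 2 ^ m)"
  obtain m0 :: nat where "2 ^ K * \<rho> < 2 ^ m0" using real_arch_pow[of 2 "2 ^ K * \<rho>"] by auto
  then have m: "2 ^ K * \<rho> \<le> 2 ^ m" unfolding m_def by (metis LeastI less_imp_le)
  have "2 ^ m \<le> 2 * (2 ^ K * \<rho>)"
  proof (cases m)
    case 0
    then show ?thesis using K assms by (simp add: field_simps)
  next
    case (Suc k)
    then have "\<not> 2 ^ K * \<rho> \<le> 2 ^ k" using not_less_Least unfolding m_def by (metis lessI)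
    then show ?thesis using Suc by simp
  qed
  with m show ?thesis by (intro that[of m K]) (auto simp: field_simps)
qed

text \<open>A difference quotient of level sets at step 1 / 2^K, averaged over translations. Its
  increasing limit in K plays the role of the perimeter of {s < f}.\<close>

definition dyadic_average :: "('a::euclidean_space \<Rightarrow> real) \<Rightarrow> nat \<Rightarrow> real \<Rightarrow> ennreal" where
  "dyadic_average f K s = (\<integral>\<^sup>+u\<in>cbox 0 One. 2 ^ K * level_diff f ((1 / 2 ^ K) *\<^sub>R u) s \<partial>lborel)"

lemma incseq_dyadic_average:
  fixes f :: "'a::euclidean_space \<Rightarrow> real"
  assumes [measurable]: "f \<in> borel_measurable borel"
  shows "incseq (\<lambda>K. dyadic_average f K s)"
proof (rule incseq_SucI)
  fix K
  have "2 ^ K * level_diff f ((1 / 2 ^ K) *\<^sub>R u) s \<le> 2 ^ Suc K * level_diff f ((1 / 2 ^ Suc K) *\<^sub>R u) s" for u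
  proof -
    have "level_diff f ((1 / 2 ^ K) *\<^sub>R u) s \<le> 2 * level_diff f ((1 / 2 ^ Suc K) *\<^sub>R u) s"
      using level_diff_double[OF assms, of "(1 / 2 ^ Suc K) *\<^sub>R u" s] by simp
    then have "2 ^ K * level_diff f ((1 / 2 ^ K) *\<^sub>R u) s \<le> 2 ^ K * (2 * level_diff f ((1 / 2 ^ Suc K) *\<^sub>R u) s)"
      by (intro mult_left_mono) auto
    then show ?thesis by (simp add: mult_ac)
  qed
  then show "dyadic_average f K s \<le> dyadic_average f (Suc K) s"
    unfolding dyadic_average_def by (intro nn_integral_mono mult_right_mono) auto
qed

text \<open>The averaging bound holds at a scale r = 2^m / 2^K that depends on e. It is reached from
  step 1 / 2^K by m doublings, at the cost of a factor 2^m = r 2^K, of which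
  \<open>dyadic_average\<close> absorbs 2^K. The supremum over K hides the choice of scale.\<close>

lemma powr_le_SUP_dyadic_average:
  fixes f :: "'a::euclidean_space \<Rightarrow> real"
  assumes [measurable]: "f \<in> borel_measurable borel"
    and e: "emeasure lborel {x. s < f x} = ennreal e" "0 \<le> e"
  shows "ennreal (e powr (1 - 1 / DIM('a))) \<le> 8 * (SUP K. dyadic_average f K s)"
proof (cases "e = 0")
  \<comment> \<open>For e = 0 the left side vanishes, since \<open>0 powr\<close> any exponent is 0,
    even for exponent 0 in dimension one.\<close>
  case False
  define n where "n = real DIM('a)"
  have n: "n \<ge> 1" unfolding n_def using DIM_positive[where 'a='a] by linarith
  define \<rho> where "\<rho> = (2 * e) powr (1 / n)"
  have \<rho>0: "0 < \<rho>" using False e by (simp add: \<rho>_def)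
  then obtain m K :: nat where mK: "\<rho> \<le> 2 ^ m / 2 ^ K" "2 ^ m / 2 ^ K \<le> 2 * \<rho>"
    by (rule ex_dyadic_between)
  define r :: real where "r = 2 ^ m / 2 ^ K"
  have r: "0 < r" by (simp add: r_def)
  have "2 * e = \<rho> powr n" using False e n by (simp add: \<rho>_def powr_powr)
  also have "\<dots> = \<rho> ^ DIM('a)" using \<rho>0 by (simp add: n_def powr_realpow)
  also have "\<dots> \<le> r ^ DIM('a)" using mK \<rho>0 by (intro power_mono) (auto simp: r_def)
  finally have "ennreal (e / 2) \<le> (\<integral>\<^sup>+u\<in>cbox 0 One. level_diff f (r *\<^sub>R u) s \<partial>lborel)"
    using e r by (intro level_diff_average_lower_bound) auto
  also have "\<dots> \<le> (\<integral>\<^sup>+u. ennreal r * (2 ^ K * level_diff f ((1 / 2 ^ K) *\<^sub>R u) s * indicator (cbox 0 One) u) \<partial>lborel)"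
  proof (intro nn_integral_mono)
    fix u :: 'a
    have "level_diff f (r *\<^sub>R u) s \<le> 2 ^ m * level_diff f ((1 / 2 ^ K) *\<^sub>R u) s"
      using level_diff_power2[OF assms(1), of m "(1 / 2 ^ K) *\<^sub>R u" s] by (simp add: r_def)
    also have "2 ^ m = ennreal r * 2 ^ K"
    proof -
      have "ennreal r * 2 ^ K = ennreal r * ennreal (2 ^ K)" by (simp flip: ennreal_power)
      also have "\<dots> = ennreal (2 ^ m)" by (simp add: r_def flip: ennreal_mult)
      finally show ?thesis by (simp flip: ennreal_power)
    qed
    finally show "level_diff f (r *\<^sub>R u) s * indicator (cbox 0 One) u
      \<le> ennreal r * (2 ^ K * level_diff f ((1 / 2 ^ K) *\<^sub>R u) s * indicator (cbox 0 One) u)"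
      by (simp add: mult.assoc[symmetric] mult_right_mono)
  qed
  also have "\<dots> = ennreal r * dyadic_average f K s"
    unfolding dyadic_average_def by (rule nn_integral_cmult) measurable
  also have "\<dots> \<le> ennreal r * (SUP K. dyadic_average f K s)"
    by (intro mult_left_mono SUP_upper) auto
  finally have *: "ennreal (e / 2) \<le> ennreal r * (SUP K. dyadic_average f K s)" .
  \<comment> \<open>Origin of 8: a factor 2 from rounding \<rho> up to r, at most 2 from
    \<open>2 powr (1 / n)\<close>, and 2 because only e / 2 is available.\<close>
  have "e powr (1 - 1 / n) * r \<le> e powr (1 - 1 / n) * (2 * \<rho>)"
    using mK by (intro mult_left_mono) (auto simp: r_def)
  also have "\<dots> = 2 * 2 powr (1 / n) * (e powr (1 - 1 / n) * e powr (1 / n))"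
    using e by (simp add: \<rho>_def powr_mult)
  also have "e powr (1 - 1 / n) * e powr (1 / n) = e" using e False by (simp flip: powr_add)
  also have "2 * 2 powr (1 / n) * e \<le> 2 * 2 powr 1 * e"
    using n e by (intro mult_right_mono mult_left_mono powr_mono) auto
  finally have "e powr (1 - 1 / n) \<le> 8 * (1 / r) * (e / 2)"
    using r by (simp add: field_simps)
  then have "ennreal (e powr (1 - 1 / n)) \<le> ennreal (8 * (1 / r) * (e / 2))" by (rule ennreal_leI)
  also have "\<dots> = 8 * ennreal (1 / r) * ennreal (e / 2)"
  proof -
    have "ennreal (8 * (1 / r) * (e / 2)) = ennreal (8 * (1 / r)) * ennreal (e / 2)"
      by (rule ennreal_mult) (use r e in auto)
    moreover have "ennreal (8 * (1 / r)) = ennreal 8 * ennreal (1 / r)"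
      by (rule ennreal_mult) (use r in auto)
    ultimately show ?thesis by (simp only: ennreal_numeral)
  qed
  also have "\<dots> \<le> 8 * ennreal (1 / r) * (ennreal r * (SUP K. dyadic_average f K s))"
    by (intro mult_left_mono *) auto
  also have "\<dots> = 8 * (ennreal (1 / r) * ennreal r) * (SUP K. dyadic_average f K s)"
    by (simp only: mult.assoc)
  also have "ennreal (1 / r) * ennreal r = 1" using r by (simp flip: ennreal_mult)
  finally show ?thesis by (simp add: n_def)
qed simp

text \<open>For fixed K the factor 2^K cancels against the length |u| / 2^K of the translation, so
  the integral over s has a bound that does not depend on K.\<close>

lemma Lorentz_bound_from_translations:
  fixes f :: "'a::euclidean_space \<Rightarrow> real" and V :: real
  assumes [measurable]: "f \<in> borel_measurable borel" and nonneg: "\<And>x. 0 \<le> f x"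
    and fin: "(\<integral>\<^sup>+x. ennreal (f x) \<partial>lborel) < \<infinity>" and V: "0 \<le> V"
    and trans: "\<And>v. (\<integral>\<^sup>+x. ennreal \<bar>f (x + v) - f x\<bar> \<partial>lborel) \<le> ennreal (norm v * V)"
  shows "(\<integral>\<^sup>+s\<in>{0..}. ennreal_powr (emeasure lborel {x. s < f x}) (1 - 1 / DIM('a)) \<partial>lborel)
     \<le> ennreal (8 * DIM('a) * V)"
proof -
  let ?C = "indicator (cbox 0 One) :: 'a \<Rightarrow> ennreal"
  note [measurable] = measurable_level_diff[OF assms(1)]
  have [measurable]: "dyadic_average f K \<in> borel_measurable borel" for K
    unfolding dyadic_average_def by measurable
  have norm_le: "norm u \<le> DIM('a)" if "u \<in> cbox 0 One" for u :: 'a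
  proof -
    have "norm u \<le> (\<Sum>b\<in>Basis. \<bar>u \<bullet> b\<bar>)" by (rule norm_le_l1)
    also have "\<dots> \<le> (\<Sum>b\<in>(Basis::'a set). 1)" using that by (intro sum_mono) (auto simp: mem_box)
    finally show ?thesis by simp
  qed
  have avg: "(\<integral>\<^sup>+s\<in>{0..}. dyadic_average f K s \<partial>lborel) \<le> ennreal (DIM('a) * V)" for K
  proof -
    have "(\<integral>\<^sup>+s\<in>{0..}. dyadic_average f K s \<partial>lborel)
       = (\<integral>\<^sup>+s. \<integral>\<^sup>+u. 2 ^ K * level_diff f ((1 / 2 ^ K) *\<^sub>R u) s * ?C u * indicator {0..} s \<partial>lborel \<partial>lborel)"
      unfolding dyadic_average_def by (subst nn_integral_multc) auto
    also have "\<dots> = (\<integral>\<^sup>+u. \<integral>\<^sup>+s. 2 ^ K * level_diff f ((1 / 2 ^ K) *\<^sub>R u) s * ?C u * indicator {0..} s \<partial>lborel \<partial>lborel)"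
      by (rule lborel_pair.Fubini') measurable
    also have "\<dots> \<le> (\<integral>\<^sup>+u. ennreal (DIM('a) * V) * ?C u \<partial>lborel)"
    proof (rule nn_integral_mono)
      fix u :: 'a
      have "(\<integral>\<^sup>+s. 2 ^ K * level_diff f ((1 / 2 ^ K) *\<^sub>R u) s * ?C u * indicator {0..} s \<partial>lborel)
        = 2 ^ K * ?C u * (\<integral>\<^sup>+s\<in>{0..}. level_diff f ((1 / 2 ^ K) *\<^sub>R u) s \<partial>lborel)"
        by (subst nn_integral_cmult[symmetric]) (auto simp: mult_ac)
      also have "\<dots> \<le> 2 ^ K * ?C u * ennreal (norm ((1 / 2 ^ K) *\<^sub>R u) * V)"
        unfolding coarea_level_diff[OF assms(1) nonneg] by (intro mult_left_mono trans) auto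
      also have "\<dots> = ?C u * ennreal (norm u * V)"
      proof -
        have "2 ^ K * ennreal (norm ((1 / 2 ^ K) *\<^sub>R u) * V) = ennreal (2 ^ K) * ennreal (norm ((1 / 2 ^ K) *\<^sub>R u) * V)"
          by (simp flip: ennreal_power)
        also have "\<dots> = ennreal (norm u * V)" using V by (simp flip: ennreal_mult)
        finally show ?thesis by (metis mult.assoc mult.commute)
      qed
      also have "\<dots> \<le> ?C u * ennreal (DIM('a) * V)"
        using norm_le V by (cases "u \<in> cbox 0 One") (auto intro!: ennreal_leI mult_right_mono simp del: mem_box)
      finally show "(\<integral>\<^sup>+s. 2 ^ K * level_diff f ((1 / 2 ^ K) *\<^sub>R u) s * ?C u * indicator {0..} s \<partial>lborel)
        \<le> ennreal (DIM('a) * V) * ?C u" by (simp add: mult.commute)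
    qed
    also have "\<dots> = ennreal (DIM('a) * V)"
      by (subst nn_integral_cmult_indicator) (auto simp: emeasure_lborel_cbox_eq)
    finally show ?thesis .
  qed
  have "(\<integral>\<^sup>+s\<in>{0..}. ennreal_powr (emeasure lborel {x. s < f x}) (1 - 1 / DIM('a)) \<partial>lborel)
     \<le> (\<integral>\<^sup>+s. (SUP K. 8 * (dyadic_average f K s * indicator {0..} s)) \<partial>lborel)"
  proof (rule nn_integral_mono_AE)
    \<comment> \<open>Markov's inequality makes {s < f} finite in measure only for s > 0; the level
      0 is a null set.\<close>
    have "AE s in lborel. s \<noteq> (0::real)" by (rule AE_lborel_singleton)
    then show "AE s in lborel. ennreal_powr (emeasure lborel {x. s < f x}) (1 - 1 / DIM('a)) * indicator {0..} s
       \<le> (SUP K. 8 * (dyadic_average f K s * indicator {0..} s))"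
    proof eventually_elim
      case (elim s)
      show ?case
      proof (cases "s > 0")
        case True
        have "{x. s < f x} \<subseteq> {x \<in> space lborel. 1 \<le> ennreal (1 / s) * ennreal (f x)}"
          using True nonneg by (auto simp flip: ennreal_mult simp: field_simps)
        then have "emeasure lborel {x. s < f x} \<le> emeasure lborel {x \<in> space lborel. 1 \<le> ennreal (1 / s) * ennreal (f x)}"
          by (intro emeasure_mono) auto
        also have "\<dots> \<le> ennreal (1 / s) * (\<integral>\<^sup>+x. ennreal (f x) * indicator UNIV x \<partial>lborel)"
          using nn_integral_Markov_inequality[of "\<lambda>x. ennreal (f x)" UNIV lborel "ennreal (1 / s)"] by simp
        also have "\<dots> < \<infinity>" using fin by (simp add: ennreal_mult_less_top)
        finally obtain e where e: "emeasure lborel {x. s < f x} = ennreal e" "0 \<le> e"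
          by (cases "emeasure lborel {x. s < f x}") auto
        have "ennreal_powr (emeasure lborel {x. s < f x}) (1 - 1 / DIM('a)) = ennreal (e powr (1 - 1 / DIM('a)))"
          using e by (simp add: ennreal_powr_def)
        also have "\<dots> \<le> 8 * (SUP K. dyadic_average f K s)"
          by (rule powr_le_SUP_dyadic_average[OF assms(1) e])
        finally show ?thesis using True by (simp add: SUP_mult_left_ennreal)
      next
        case False
        then show ?thesis using elim by simp
      qed
    qed
  qed
  also have "\<dots> = (SUP K. \<integral>\<^sup>+s. 8 * (dyadic_average f K s * indicator {0..} s) \<partial>lborel)"
    using incseq_dyadic_average[OF assms(1)]
    by (intro nn_integral_monotone_convergence_SUP) (auto simp: incseq_def le_fun_def intro!: mult_left_mono mult_right_mono)
  also have "\<dots> \<le> 8 * ennreal (DIM('a) * V)"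
  proof (rule SUP_least)
    fix K
    have "(\<integral>\<^sup>+s. 8 * (dyadic_average f K s * indicator {0..} s) \<partial>lborel) = 8 * (\<integral>\<^sup>+s\<in>{0..}. dyadic_average f K s \<partial>lborel)"
      by (rule nn_integral_cmult) measurable
    also have "\<dots> \<le> 8 * ennreal (DIM('a) * V)" by (intro mult_left_mono avg) auto
    finally show "(\<integral>\<^sup>+s. 8 * (dyadic_average f K s * indicator {0..} s) \<partial>lborel) \<le> 8 * ennreal (DIM('a) * V)" .
  qed
  also have "\<dots> = ennreal (8 * DIM('a) * V)" using V by (simp add: ennreal_mult mult.assoc)
  finally show ?thesis .
qed

section \<open>Test fields from segment averages\<close>

lemma partial_eqI:
  assumes "(f has_derivative D) (at x)"
  shows "partial i f x = D (axis i 1)"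
  using frechet_derivative_at[OF assms] by (simp add: partial_def)

lemma has_derivative_partials:
  fixes f :: "real ^ 'n::finite \<Rightarrow> real"
  assumes "f differentiable (at x)"
  shows "(f has_derivative (\<lambda>h. \<Sum>i\<in>UNIV. partial i f x * h $ i)) (at x)"
proof -
  let ?D = "frechet_derivative f (at x)"
  have D: "(f has_derivative ?D) (at x)" using assms by (simp add: frechet_derivative_works)
  then interpret D: linear ?D by (rule has_derivative_linear)
  have "?D h = (\<Sum>i\<in>UNIV. partial i f x * h $ i)" for h
  proof -
    have "?D h = ?D (\<Sum>i\<in>UNIV. h $ i *s axis i 1)" by (simp add: basis_expansion)
    also have "\<dots> = (\<Sum>i\<in>UNIV. partial i f x * h $ i)"
      by (simp add: D.sum D.scaleR partial_def mult.commute flip: scalar_mult_eq_scaleR)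
         (simp add: scalar_mult_eq_scaleR D.scaleR mult.commute)
    finally show ?thesis .
  qed
  then show ?thesis using D by (metis (no_types, lifting) ext)
qed

lemma C_k_continuous: "C_k k f \<Longrightarrow> continuous_on UNIV f"
  by (cases k) (auto simp: continuous_on_eq_continuous_within differentiable_imp_continuous_within)

lemma C_k_cmult: "C_k k f \<Longrightarrow> C_k k (\<lambda>x. f x * c)"
proof (induction k arbitrary: f)
  case 0
  then show ?case by (auto intro: continuous_intros)
next
  case (Suc k)
  have "partial i (\<lambda>x. f x * c) = (\<lambda>x. partial i f x * c)" for i
  proof
    fix x
    have "(f has_derivative frechet_derivative f (at x)) (at x)"
      using Suc.prems by (simp add: frechet_derivative_works)
    from partial_eqI[OF has_derivative_mult_left[OF this, of c], of i] show "partial i (\<lambda>x. f x * c) x = partial i f x * c"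
        by (simp add: partial_def)
  qed
  then show ?case using Suc by auto
qed

subsection \<open>Smooth functions with compact support\<close>

text \<open>The case m = 0 is the classical flat function. The powers of t in the denominator make
  the family closed under differentiation up to linear combinations.\<close>

definition bump :: "nat \<Rightarrow> real \<Rightarrow> real" where
  "bump m t = (if 0 < t then exp (- 1 / t) / t ^ m else 0)"

lemma bump_tendsto_0: "(bump m \<longlongrightarrow> 0) (at_right 0)"
proof -
  have "((\<lambda>t::real. inverse t ^ m / exp (inverse t)) \<longlongrightarrow> 0) (at_right 0)"
    by (rule filterlim_compose[OF tendsto_power_div_exp_0 filterlim_inverse_at_top_right])
  then show ?thesis
    by (rule Lim_transform_eventually)
      (auto simp: eventually_at_filter bump_def exp_minus field_simps)
qed

lemma bump_has_derivative:
  "(bump m has_real_derivative bump (m + 2) t - m * bump (m + 1) t) (at t)"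
proof -
  consider "t > 0" | "t < 0" | "t = 0" by linarith
  then show ?thesis
  proof cases
    case 1
    have "((\<lambda>t. exp (- 1 / t) / t ^ m) has_real_derivative bump (m + 2) t - m * bump (m + 1) t) (at t)"
      using 1
      apply (auto intro!: derivative_eq_intros simp: bump_def)
      apply (cases m; simp add: field_simps power2_eq_square)
      done
    then show ?thesis
      by (rule has_field_derivative_transform_within_open[of _ _ _ "{0<..}"]) (use 1 in \<open>auto simp: bump_def\<close>)
  next
    case 2
    have "((\<lambda>t. 0) has_real_derivative bump (m + 2) t - m * bump (m + 1) t) (at t)"
      using 2 by (simp add: bump_def)
    then show ?thesis
      by (rule has_field_derivative_transform_within_open[of _ _ _ "{..<0}"]) (use 2 in \<open>auto simp: bump_def\<close>)
  next
    case 3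
    \<comment> \<open>At 0 the difference quotient from the right is again a member of the family,
      \<open>bump (Suc m)\<close>, and therefore tends to 0.\<close>
    have r: "((\<lambda>h. bump m h / h) \<longlongrightarrow> 0) (at_right 0)"
      by (rule Lim_transform_eventually[OF bump_tendsto_0[of "Suc m"]])
        (auto simp: eventually_at_filter bump_def)
    have l: "((\<lambda>h. bump m h / h) \<longlongrightarrow> 0) (at_left 0)"
      by (rule Lim_transform_eventually[OF tendsto_const])
        (auto simp: eventually_at_filter bump_def)
    have "((\<lambda>h. bump m h / h) \<longlongrightarrow> 0) (at 0)" using l r by (simp add: filterlim_split_at)
    then show ?thesis using 3 by (simp add: DERIV_def bump_def)
  qed
qed

lemma bump_0_bounds: "0 \<le> bump 0 t" "bump 0 t \<le> 1"
  by (auto simp: bump_def)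

lemma real_polynomial_function_partial:
  fixes p :: "real ^ 'n::finite \<Rightarrow> real"
  assumes "real_polynomial_function p"
  shows "p differentiable (at x)" "real_polynomial_function (partial i p)"
proof -
  have "(\<forall>x. p differentiable (at x)) \<and> real_polynomial_function (partial i p)"
    using assms
  proof induction
    case (linear f)
    have D: "(f has_derivative f) (at x)" for x
      using linear by (rule bounded_linear_imp_has_derivative)
    have "partial i f = (\<lambda>x. f (axis i 1))" using partial_eqI[OF D] by auto
    then show ?case using D by (auto simp: differentiable_def)
  next
    case (const c)
    have "((\<lambda>x. c) has_derivative (\<lambda>h. 0)) (at x)" for x :: "real ^ 'n" by simp
    from partial_eqI[OF this] have "partial i (\<lambda>x. c) = (\<lambda>x. 0)" by auto
    then show ?case by auto
  next
    case (add f g)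
    have "partial i (\<lambda>x. f x + g x) = (\<lambda>x. partial i f x + partial i g x)"
    proof
      fix x
      have "(f has_derivative frechet_derivative f (at x)) (at x)" "(g has_derivative frechet_derivative g (at x)) (at x)"
        using add by (auto simp: frechet_derivative_works)
      from partial_eqI[OF has_derivative_add[OF this], of i] show "partial i (\<lambda>x. f x + g x) x = partial i f x + partial i g x"
        by (simp add: partial_def)
    qed
    then show ?case using add by auto
  next
    case (mult f g)
    have "partial i (\<lambda>x. f x * g x) = (\<lambda>x. f x * partial i g x + partial i f x * g x)"
    proof
      fix x
      have "(f has_derivative frechet_derivative f (at x)) (at x)" "(g has_derivative frechet_derivative g (at x)) (at x)"
        using mult by (auto simp: frechet_derivative_works)
      from partial_eqI[OF has_derivative_mult[OF this], of i] show "partial i (\<lambda>x. f x * g x) x = f x * partial i g x + partial i f x * g x"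
        by (simp add: partial_def)
    qed
    then show ?case using mult by auto
  qed
  then show "p differentiable (at x)" "real_polynomial_function (partial i p)" by auto
qed

text \<open>A class closed under partial derivatives whose members vanish where |x|^2 >= R. Closure
  yields smoothness by induction on k, without product or chain rules for
  \<open>C_k\<close>.\<close>

inductive bump_polynomial :: "real \<Rightarrow> (real ^ 'n::finite \<Rightarrow> real) \<Rightarrow> bool" for R where
  mult: "real_polynomial_function p \<Longrightarrow> bump_polynomial R (\<lambda>x. p x * bump m (R - x \<bullet> x))"
| add: "bump_polynomial R f \<Longrightarrow> bump_polynomial R g \<Longrightarrow> bump_polynomial R (\<lambda>x. f x + g x)"

lemma bump_polynomial_partial:
  fixes f :: "real ^ 'n::finite \<Rightarrow> real"
  assumes "bump_polynomial R f"
  shows "f differentiable (at x)" "bump_polynomial R (partial i f)"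
proof -
  have "(\<forall>x. f differentiable (at x)) \<and> bump_polynomial R (partial i f)"
    using assms
  proof induction
    case (mult p m)
    have D: "((\<lambda>x. p x * bump m (R - x \<bullet> x)) has_derivative
        (\<lambda>h. p x * ((bump (m + 2) (R - x \<bullet> x) - m * bump (m + 1) (R - x \<bullet> x)) * (0 - (x \<bullet> h + h \<bullet> x)))
           + frechet_derivative p (at x) h * bump m (R - x \<bullet> x))) (at x)" for x
    proof (rule has_derivative_mult)
      show "(p has_derivative frechet_derivative p (at x)) (at x)"
        using real_polynomial_function_partial(1)[OF mult] by (simp add: frechet_derivative_works)
      have "((\<lambda>x. R - x \<bullet> x) has_derivative (\<lambda>h. 0 - (x \<bullet> h + h \<bullet> x))) (at x)"
        by (intro derivative_intros)
      then show "((\<lambda>x. bump m (R - x \<bullet> x)) has_derivative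
        (\<lambda>h. (bump (m + 2) (R - x \<bullet> x) - m * bump (m + 1) (R - x \<bullet> x)) * (0 - (x \<bullet> h + h \<bullet> x)))) (at x)"
        by (rule has_derivative_compose[where g = "bump m"])
          (use bump_has_derivative[of m "R - x \<bullet> x"] in \<open>simp add: has_field_derivative_def\<close>)
    qed
    have "partial i (\<lambda>x. p x * bump m (R - x \<bullet> x)) = (\<lambda>x.
       ((- 2 * x $ i) * p x) * bump (m + 2) (R - x \<bullet> x)
       + ((2 * real m * x $ i) * p x * bump (m + 1) (R - x \<bullet> x)
         + partial i p x * bump m (R - x \<bullet> x)))"
      using partial_eqI[OF D] by (auto simp: partial_def inner_axis inner_axis' algebra_simps)
    moreover have lin: "real_polynomial_function (\<lambda>x::real ^ 'n. c * x $ i)" for c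
      by (intro real_polynomial_function.intros(1) bounded_linear_intros bounded_linear_vec_nth)
    have "bump_polynomial R (\<lambda>x. ((- 2 * x $ i) * p x) * bump (m + 2) (R - x \<bullet> x)
       + ((2 * real m * x $ i) * p x * bump (m + 1) (R - x \<bullet> x)
         + partial i p x * bump m (R - x \<bullet> x)))"
      by (intro bump_polynomial.intros real_polynomial_function.intros(4) lin mult real_polynomial_function_partial(2))
    ultimately have "bump_polynomial R (partial i (\<lambda>x. p x * bump m (R - x \<bullet> x)))" by simp
    then show ?case using D by (auto simp: differentiable_def)
  next
    case (add f g)
    have "partial i (\<lambda>x. f x + g x) = (\<lambda>x. partial i f x + partial i g x)"
    proof
      fix x
      have "(f has_derivative frechet_derivative f (at x)) (at x)" "(g has_derivative frechet_derivative g (at x)) (at x)"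
        using add by (auto simp: frechet_derivative_works)
      from partial_eqI[OF has_derivative_add[OF this], of i] show "partial i (\<lambda>x. f x + g x) x = partial i f x + partial i g x"
        by (simp add: partial_def)
    qed
    then show ?case using add by (auto intro: bump_polynomial.add)
  qed
  then show "f differentiable (at x)" "bump_polynomial R (partial i f)" by auto
qed

lemma smooth_bump_polynomial:
  assumes "bump_polynomial R f"
  shows "smooth f"
proof -
  have "C_k k f" for k
    using assms
  proof (induction k arbitrary: f)
    case 0
    then show ?case
      by (auto simp: continuous_on_eq_continuous_within intro!: differentiable_imp_continuous_within bump_polynomial_partial)
  next
    case (Suc k)
    then show ?case using bump_polynomial_partial[OF Suc.prems] by auto
  qed
  then show ?thesis by (simp add: smooth_def)
qed

subsection \<open>Averages along segments\<close>

text \<open>The convolution of f with the uniform probability measure on the segment from 0 to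
  v.\<close>

definition segment_average :: "real ^ 'n::finite \<Rightarrow> (real ^ 'n \<Rightarrow> real) \<Rightarrow> real ^ 'n \<Rightarrow> real" where
  "segment_average v f y = integral {0..1} (\<lambda>t. f (y - t *\<^sub>R v))"

lemma continuous_segment_average:
  assumes "continuous_on UNIV f"
  shows "continuous_on UNIV (segment_average v f)"
  unfolding segment_average_def
  unfolding box_real(2)[symmetric]
  by (rule integral_continuous_on_param)
    (auto intro!: continuous_intros continuous_on_compose2[OF assms] simp: case_prod_unfold)

lemma has_derivative_segment_average:
  fixes f :: "real ^ 'n::finite \<Rightarrow> real"
  assumes diff: "\<And>x. f differentiable (at x)" and cont: "\<And>i. continuous_on UNIV (partial i f)"
  shows "(segment_average v f has_derivative (\<lambda>h. \<Sum>i\<in>UNIV. segment_average v (partial i f) y * h $ i)) (at y)"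
proof -
  \<comment> \<open>The derivative of x - t v under f, as a bounded linear map: differentiation
    under the integral asks for its joint continuity in x and t.\<close>
  define F where "F x t = (\<Sum>i\<in>UNIV. partial i f (x - t *\<^sub>R v) *\<^sub>R blinfun_inner_left (axis i 1 :: real ^ 'n))"
    for x and t :: real
  have Fap: "blinfun_apply (F x t) h = (\<Sum>i\<in>UNIV. partial i f (x - t *\<^sub>R v) * h $ i)" for x t h
    by (simp add: F_def blinfun.sum_left blinfun.scaleR_left inner_axis)
  have contf: "continuous_on UNIV f"
    using diff by (auto simp: continuous_on_eq_continuous_within intro: differentiable_imp_continuous_within)
  have contF: "continuous_on (UNIV \<times> cbox 0 1) (\<lambda>(x, t). F x t)"
    unfolding F_def case_prod_unfold
    by (intro continuous_intros continuous_on_compose2[OF cont]) auto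
  have contF': "continuous_on (cbox 0 1) (F y)"
    unfolding F_def by (intro continuous_intros continuous_on_compose2[OF cont]) auto
  have "((\<lambda>x. integral (cbox 0 1) (\<lambda>t. f (x - t *\<^sub>R v))) has_derivative integral (cbox 0 1) (F y)) (at y within UNIV)"
  proof (rule leibniz_rule[OF _ _ contF])
    fix x and t :: real
    have "((\<lambda>x. x - t *\<^sub>R v) has_derivative (\<lambda>h. h)) (at x)"
      by (auto intro!: derivative_eq_intros)
    from has_derivative_compose[OF this has_derivative_partials[OF diff]]
    show "((\<lambda>x. f (x - t *\<^sub>R v)) has_derivative F x t) (at x within UNIV)"
      by (simp add: Fap[abs_def])
  next
    fix x :: "real ^ 'n"
    show "(\<lambda>t. f (x - t *\<^sub>R v)) integrable_on cbox 0 1"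
      by (intro integrable_continuous continuous_on_compose2[OF contf] continuous_intros) auto
  qed auto
  moreover have "blinfun_apply (integral (cbox 0 1) (F y)) h = (\<Sum>i\<in>UNIV. segment_average v (partial i f) y * h $ i)" for h
  proof -
    have "F y integrable_on cbox 0 1" by (rule integrable_continuous[OF contF'])
    then have "blinfun_apply (integral (cbox 0 1) (F y)) h = integral (cbox 0 1) (\<lambda>t. \<Sum>i\<in>UNIV. partial i f (y - t *\<^sub>R v) * h $ i)"
      by (simp add: blinfun_apply_integral Fap)
    also have "\<dots> = (\<Sum>i\<in>UNIV. integral (cbox 0 1) (\<lambda>t. partial i f (y - t *\<^sub>R v) * h $ i))"
      by (intro integral_sum integrable_continuous continuous_intros continuous_on_compose2[OF cont]) auto
    finally show ?thesis by (simp add: segment_average_def)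
  qed
  then have "blinfun_apply (integral (cbox 0 1) (F y)) = (\<lambda>h. \<Sum>i\<in>UNIV. segment_average v (partial i f) y * h $ i)"
    by auto
  ultimately show ?thesis
    by (simp add: segment_average_def[abs_def])
qed

text \<open>Averaging commutes with partial derivatives, so every order reduces to
  continuity.\<close>

lemma C_k_segment_average:
  "C_k k f \<Longrightarrow> C_k k (segment_average v f)"
proof (induction k arbitrary: f)
  case 0
  then show ?case by (simp add: continuous_segment_average)
next
  case (Suc k)
  then have D: "(segment_average v f has_derivative (\<lambda>h. \<Sum>i\<in>UNIV. segment_average v (partial i f) y * h $ i)) (at y)" for y
    by (intro has_derivative_segment_average) (auto intro: C_k_continuous)
  have "partial i (segment_average v f) = segment_average v (partial i f)" for i
    using partial_eqI[OF D] by (auto simp: axis_def if_distrib cong: if_cong)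
  then show ?case using Suc D by (auto simp: differentiable_def)
qed

text \<open>The derivative of f in direction v at y - t v is the t-derivative of - f (y - t v), so
  the fundamental theorem evaluates the average.\<close>

lemma segment_average_derivative_along:
  fixes f :: "real ^ 'n::finite \<Rightarrow> real"
  assumes diff: "\<And>x. f differentiable (at x)" and cont: "\<And>i. continuous_on UNIV (partial i f)"
  shows "(\<Sum>i\<in>UNIV. segment_average v (partial i f) y * v $ i) = f y - f (y - v)"
proof -
  have "(\<Sum>i\<in>UNIV. segment_average v (partial i f) y * v $ i)
     = (\<Sum>i\<in>UNIV. integral {0..1} (\<lambda>t. partial i f (y - t *\<^sub>R v) * v $ i))"
    by (simp add: segment_average_def)
  also have "\<dots> = integral {0..1} (\<lambda>t. \<Sum>i\<in>UNIV. partial i f (y - t *\<^sub>R v) * v $ i)"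
    by (intro integral_sum[symmetric] integrable_continuous_real continuous_intros continuous_on_compose2[OF cont]) auto
  also have "((\<lambda>t. \<Sum>i\<in>UNIV. partial i f (y - t *\<^sub>R v) * v $ i) has_integral (- f (y - 1 *\<^sub>R v) - - f (y - 0 *\<^sub>R v))) {0..1}"
  proof (rule fundamental_theorem_of_calculus)
    fix t :: real
    have "((\<lambda>t. y - t *\<^sub>R v) has_derivative (\<lambda>h. - (h *\<^sub>R v))) (at t within {0..1})"
      by (auto intro!: derivative_eq_intros)
    from has_derivative_minus[OF has_derivative_compose[OF this has_derivative_partials[OF diff]]]
    show "((\<lambda>t. - f (y - t *\<^sub>R v)) has_vector_derivative (\<Sum>i\<in>UNIV. partial i f (y - t *\<^sub>R v) * v $ i)) (at t within {0..1})"
      by (simp add: has_vector_derivative_def sum_negf sum_distrib_left mult_ac)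
  qed simp
  then have "integral {0..1} (\<lambda>t. \<Sum>i\<in>UNIV. partial i f (y - t *\<^sub>R v) * v $ i) = f y - f (y - v)"
    by (simp add: integral_unique)
  finally show ?thesis .
qed

text \<open>The fixed direction \<open>sgn v\<close> makes the length of the field |average of
  \<psi>| <= 1 and its divergence a single directional derivative. Averaging enlarges the support by
  at most |v|.\<close>

lemma segment_average_test_field:
  fixes \<psi> :: "real ^ 'n::finite \<Rightarrow> real"
  assumes "smooth \<psi>" and supp: "\<And>x. \<rho> < norm x \<Longrightarrow> \<psi> x = 0" and le1: "\<And>x. \<bar>\<psi> x\<bar> \<le> 1"
    and "v \<noteq> 0"
  shows "(\<lambda>y. segment_average v \<psi> y *\<^sub>R sgn v) \<in> test_fields"
    and "divergence (\<lambda>y. segment_average v \<psi> y *\<^sub>R sgn v) y = (\<psi> y - \<psi> (y - v)) / norm v"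
proof -
  let ?A = "segment_average v \<psi>"
  have Ck: "C_k k \<psi>" for k using assms by (simp add: smooth_def)
  then have contp: "continuous_on UNIV \<psi>" using C_k_continuous by blast
  have diff: "\<psi> differentiable (at x)" and cont: "continuous_on UNIV (partial i \<psi>)" for x i
    using Ck[of 1] by auto
  have CkA: "C_k k (\<lambda>y. ?A y * sgn v $ i)" for k i
    by (intro C_k_cmult C_k_segment_average Ck)
  have contA: "continuous_on UNIV ?A" by (rule continuous_segment_average[OF contp])
  have int: "(\<lambda>t. \<psi> (y - t *\<^sub>R v)) integrable_on {0..1}" for y
    by (intro integrable_continuous_real continuous_on_compose2[OF contp] continuous_intros) auto
  have A1: "\<bar>?A y\<bar> \<le> 1" for y
    using integral_norm_bound_integral[OF int[of y] integrable_const_ivl[of 1]] le1 by (simp add: segment_average_def)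
  have "{y. ?A y *\<^sub>R sgn v \<noteq> 0} \<subseteq> cball 0 (\<rho> + norm v)"
  proof
    fix y assume y: "y \<in> {y. ?A y *\<^sub>R sgn v \<noteq> 0}"
    show "y \<in> cball 0 (\<rho> + norm v)"
    proof (rule ccontr)
      assume "y \<notin> cball 0 (\<rho> + norm v)"
      then have *: "\<rho> + norm v < norm y" by simp
      have "\<psi> (y - t *\<^sub>R v) = 0" if "t \<in> {0..1}" for t
      proof (rule supp)
        have "norm (t *\<^sub>R v) \<le> norm v" using that by (simp add: mult_left_le_one_le)
        moreover have "norm y - norm (t *\<^sub>R v) \<le> norm (y - t *\<^sub>R v)" by (rule norm_triangle_ineq2)
        ultimately show "\<rho> < norm (y - t *\<^sub>R v)" using * by linarith
      qed
      then have "?A y = integral {0..1} (\<lambda>t::real. 0)"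
        unfolding segment_average_def by (intro integral_cong) auto
      then show False using y by simp
    qed
  qed
  then have "compact (closure {y. ?A y *\<^sub>R sgn v \<noteq> 0})"
    using bounded_subset[OF bounded_cball] by (simp add: compact_closure)
  moreover have "esssup lebesgue (\<lambda>y. ereal (norm (?A y *\<^sub>R sgn v))) \<le> 1"
  proof (rule esssup_I)
    have "?A \<in> borel_measurable borel" using contA by (rule borel_measurable_continuous_onI)
    then have [measurable]: "?A \<in> borel_measurable lebesgue"
      by (simp add: measurable_completion)
    show "(\<lambda>y. ereal (norm (?A y *\<^sub>R sgn v))) \<in> borel_measurable lebesgue" by measurable
    show "AE y in lebesgue. ereal (norm (?A y *\<^sub>R sgn v)) \<le> 1"
      using A1 \<open>v \<noteq> 0\<close> by (simp add: norm_sgn)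
  qed
  ultimately show "(\<lambda>y. ?A y *\<^sub>R sgn v) \<in> test_fields"
    unfolding test_fields_def smooth_def using CkA by auto
  have D: "(?A has_derivative (\<lambda>h. \<Sum>i\<in>UNIV. segment_average v (partial i \<psi>) y * h $ i)) (at y)"
    by (rule has_derivative_segment_average[OF diff cont])
  have "partial i (\<lambda>y. ?A y * sgn v $ i) y = segment_average v (partial i \<psi>) y * sgn v $ i" for i
    using partial_eqI[OF has_derivative_mult_left[OF D, of "sgn v $ i"]]
    by (simp add: axis_def if_distrib cong: if_cong)
  then have "divergence (\<lambda>y. ?A y *\<^sub>R sgn v) y = (\<Sum>i\<in>UNIV. segment_average v (partial i \<psi>) y * v $ i) / norm v"
    by (simp add: divergence_def sgn_div_norm sum_distrib_left divide_inverse mult_ac)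
  then show "divergence (\<lambda>y. ?A y *\<^sub>R sgn v) y = (\<psi> y - \<psi> (y - v)) / norm v"
    by (simp add: segment_average_derivative_along[OF diff cont])
qed

subsection \<open>Translation estimate\<close>

text \<open>The ideal test function sgn g is an a.e. limit of admissible \<psi>: continuous
  approximants are replaced by polynomials on growing balls and cut off by bumps that tend to 1.
  Dominated convergence with |g| passes to the limit.\<close>

lemma L1_norm_le_by_duality:
  fixes g :: "real ^ 'n::finite \<Rightarrow> real"
  assumes g: "integrable lebesgue g"
    and bound: "\<And>\<psi> \<rho>. smooth \<psi> \<Longrightarrow> (\<And>x. \<rho> < norm x \<Longrightarrow> \<psi> x = 0) \<Longrightarrow> (\<And>x. \<bar>\<psi> x\<bar> \<le> 1)
      \<Longrightarrow> (LINT x|lebesgue. g x * \<psi> x) \<le> C"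
  shows "(LINT x|lebesgue. \<bar>g x\<bar>) \<le> C"
proof -
  have [measurable]: "g \<in> borel_measurable lebesgue" using g by simp
  have "(\<lambda>x. sgn (g x)) \<in> borel_measurable lebesgue" by measurable
  then have "(\<lambda>x. sgn (g x)) measurable_on UNIV"
    by (intro lebesgue_measurable_imp_measurable_on) auto
  then obtain N \<theta> where N: "negligible N" and \<theta>c: "\<And>n. continuous_on UNIV (\<theta> n)"
    and \<theta>: "\<And>x. x \<notin> N \<Longrightarrow> (\<lambda>n. \<theta> n x) \<longlonglongrightarrow> sgn (g x)"
    unfolding measurable_on_def by auto
  \<comment> \<open>Clamping to [-1, 1] keeps the limit, because sgn takes values there.\<close>
  define \<theta>' where "\<theta>' n x = max (- 1) (min 1 (\<theta> n x))" for n :: nat and x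
  have "continuous_on (cball 0 (real n)) (\<theta>' n)" for n
    unfolding \<theta>'_def by (intro continuous_intros continuous_on_subset[OF \<theta>c]) auto
  then have "\<exists>p. real_polynomial_function p \<and> (\<forall>x\<in>cball 0 (real n). \<bar>\<theta>' n x - p x\<bar> < 1 / Suc n)" for n
    using Stone_Weierstrass_real_polynomial_function[of "cball 0 (real n)" "\<theta>' n" "1 / Suc n"]
    by (metis compact_cball divide_pos_pos of_nat_0_less_iff zero_less_Suc zero_less_one)
  then obtain p where p: "\<And>n. real_polynomial_function (p n)"
    and approx: "\<And>n x. x \<in> cball 0 (real n) \<Longrightarrow> \<bar>\<theta>' n x - p n x\<bar> < 1 / Suc n" by metis
  \<comment> \<open>On the ball |p n| <= 1 + 1 / (n + 1); dividing by this restores the bound 1 and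
    disappears in the limit.\<close>
  define c :: "nat \<Rightarrow> real" where "c n = 1 / (1 + 1 / Suc n)" for n
  define \<psi> where "\<psi> n x = c n * p n x * bump 0 (real n - x \<bullet> x)" for n x
  \<comment> \<open>The bump lives where |x|^2 < n. This forces n >= 1, hence |x| <= n, so the
    polynomial is cut off before it leaves the ball on which it is controlled.\<close>
  have inside: "x \<in> cball 0 (real n)" if "x \<bullet> x < real n" for x :: "real ^ 'n" and n
  proof -
    have "0 < real n" using that inner_ge_zero[of x] by linarith
    then have "1 \<le> n" by simp
    then have "real n \<le> (real n)\<^sup>2" by (simp add: power2_eq_square)
    then have "(norm x)\<^sup>2 \<le> (real n)\<^sup>2" using that unfolding power2_norm_eq_inner by linarith
    then show ?thesis by (simp add: abs_le_square_iff[symmetric])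
  qed
  have smooth: "smooth (\<psi> n)" for n
    unfolding \<psi>_def
    by (intro smooth_bump_polynomial[of "real n"] bump_polynomial.mult real_polynomial_function.intros(4) real_polynomial_function.intros(2) p)
  have supp: "\<psi> n x = 0" if "real n < norm x" for n x
    using inside[of x n] that by (force simp: \<psi>_def bump_def)
  have le1: "\<bar>\<psi> n x\<bar> \<le> 1" for n x
  proof (cases "x \<bullet> x < real n")
    case True
    have "\<bar>p n x\<bar> \<le> 1 + 1 / Suc n"
      using approx[OF inside[OF True]] unfolding \<theta>'_def by (simp add: abs_le_iff abs_less_iff) linarith
    then have "\<bar>c n * p n x\<bar> \<le> 1" by (simp add: c_def abs_mult divide_simps mult.commute)
    moreover have "\<bar>bump 0 (real n - x \<bullet> x)\<bar> \<le> 1" using bump_0_bounds by (simp add: abs_le_iff)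
    ultimately show ?thesis unfolding \<psi>_def by (metis abs_ge_zero abs_mult mult_le_one)
  qed (simp add: \<psi>_def bump_def)
  have lim: "(\<lambda>n. \<psi> n x) \<longlonglongrightarrow> sgn (g x)" if "x \<notin> N" for x
  proof -
    have "(\<lambda>n. \<theta>' n x) \<longlonglongrightarrow> max (- 1) (min 1 (sgn (g x)))"
      unfolding \<theta>'_def by (intro tendsto_intros \<theta>[OF that])
    then have "(\<lambda>n. \<theta>' n x) \<longlonglongrightarrow> sgn (g x)" by (simp add: sgn_real_def max_def min_def split: if_splits)
    moreover have "(\<lambda>n. p n x - \<theta>' n x) \<longlonglongrightarrow> 0"
    proof (rule Lim_null_comparison)
      have "\<forall>\<^sub>F n in sequentially. norm x \<le> real n"
        using filterlim_real_sequentially by (simp add: filterlim_at_top)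
      then show "\<forall>\<^sub>F n in sequentially. norm (p n x - \<theta>' n x) \<le> 1 / Suc n"
      proof eventually_elim
        case (elim n)
        then have "\<bar>\<theta>' n x - p n x\<bar> < 1 / Suc n" by (intro approx) simp
        then show ?case by (simp add: abs_minus_commute)
      qed
      show "(\<lambda>n. 1 / real (Suc n)) \<longlonglongrightarrow> 0" by (rule LIMSEQ_Suc[OF lim_1_over_n])
    qed
    ultimately have "(\<lambda>n. \<theta>' n x + (p n x - \<theta>' n x)) \<longlonglongrightarrow> sgn (g x) + 0" by (rule tendsto_add)
    then have P: "(\<lambda>n. p n x) \<longlonglongrightarrow> sgn (g x)" by simp
    have c: "c \<longlonglongrightarrow> 1 / (1 + 0)"
      unfolding c_def by (intro tendsto_intros LIMSEQ_Suc[OF lim_1_over_n]) auto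
    have "(\<lambda>n. exp (- (1 / (real n - x \<bullet> x)))) \<longlonglongrightarrow> exp (- 0)"
    proof (intro tendsto_intros tendsto_divide_0[OF tendsto_const] filterlim_at_top_imp_at_infinity)
      show "filterlim (\<lambda>n. real n - x \<bullet> x) at_top sequentially"
        using filterlim_tendsto_add_at_top[OF tendsto_const[of "- (x \<bullet> x)"] filterlim_real_sequentially]
        by simp
    qed
    moreover have "\<forall>\<^sub>F n in sequentially. exp (- (1 / (real n - x \<bullet> x))) = bump 0 (real n - x \<bullet> x)"
    proof -
      obtain n0 :: nat where "x \<bullet> x < real n0" using reals_Archimedean2 by blast
      show ?thesis using eventually_ge_at_top[of n0]
      proof eventually_elim
        case (elim n)
        then have "real n0 \<le> real n" by simp
        then have "x \<bullet> x < real n" using \<open>x \<bullet> x < real n0\<close> by linarith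
        then show ?case by (simp add: bump_def)
      qed
    qed
    ultimately have "(\<lambda>n. bump 0 (real n - x \<bullet> x)) \<longlonglongrightarrow> exp (- 0)"
      by (rule Lim_transform_eventually)
    then have "(\<lambda>n. bump 0 (real n - x \<bullet> x)) \<longlonglongrightarrow> 1" by simp
    then have "(\<lambda>n. c n * p n x * bump 0 (real n - x \<bullet> x)) \<longlonglongrightarrow> 1 / (1 + 0) * sgn (g x) * 1"
      by (intro tendsto_mult c P)
    then show ?thesis by (simp add: \<psi>_def)
  qed
  have [measurable]: "\<psi> n \<in> borel_measurable lebesgue" for n
  proof -
    have "continuous_on UNIV (\<psi> n)" using smooth C_k_continuous by (metis smooth_def)
    then show ?thesis by (simp add: borel_measurable_continuous_onI measurable_completion)
  qed
  have "(\<lambda>n. LINT x|lebesgue. g x * \<psi> n x) \<longlonglongrightarrow> (LINT x|lebesgue. \<bar>g x\<bar>)"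
  proof (rule integral_dominated_convergence)
    show "integrable lebesgue (\<lambda>x. \<bar>g x\<bar>)" using g by (rule integrable_abs)
    have "AE x in lebesgue. x \<notin> N"
      using N by (simp add: AE_not_in negligible_iff_null_sets)
    then show "AE x in lebesgue. (\<lambda>n. g x * \<psi> n x) \<longlonglongrightarrow> \<bar>g x\<bar>"
    proof eventually_elim
      case (elim x)
      have "(\<lambda>n. g x * \<psi> n x) \<longlonglongrightarrow> g x * sgn (g x)"
        by (intro tendsto_mult tendsto_const lim elim)
      then show ?case by (simp add: abs_sgn)
    qed
    show "AE x in lebesgue. norm (g x * \<psi> n x) \<le> \<bar>g x\<bar>" for n
      using le1 by (auto simp: abs_mult mult_left_le)
  qed measurable
  moreover have "(LINT x|lebesgue. g x * \<psi> n x) \<le> C" for n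
    by (rule bound[OF smooth, of "real n"]) (auto simp: supp le1)
  ultimately show ?thesis by (intro LIMSEQ_le_const2) auto
qed

lemma integral_lborel_translate:
  fixes g :: "'a::euclidean_space \<Rightarrow> real"
  assumes [measurable]: "g \<in> borel_measurable borel"
  shows "(LINT x|lborel. g (x + v)) = (LINT x|lborel. g x)"
    and "integrable lborel g \<Longrightarrow> integrable lborel (\<lambda>x. g (x + v))"
proof -
  have "(LINT x|lborel. g x) = (LINT x|distr lborel borel ((+) v). g x)"
    by (simp add: lborel_distr_plus)
  also have "\<dots> = (LINT x|lborel. g (x + v))"
    by (subst integral_distr) (auto simp: add.commute)
  finally show "(LINT x|lborel. g (x + v)) = (LINT x|lborel. g x)" by simp
  assume "integrable lborel g"
  then have "integrable (distr lborel borel ((+) v)) g" by (simp add: lborel_distr_plus)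
  then show "integrable lborel (\<lambda>x. g (x + v))"
    by (subst (asm) integrable_distr_eq) (auto simp: add.commute)
qed

text \<open>A change of variables moves the difference from \<psi> to f: the integral of f (\<psi> x
  - \<psi> (x - v)) is that of (f x - f (x + v)) \<psi> x. The given function \<open>f0\<close>
  enters the seminorm, while its Borel representative f is used for integrals over
  \<open>lborel\<close>.\<close>

lemma L1_translation_le_BV_seminorm:
  fixes f :: "real ^ 'n::finite \<Rightarrow> real"
  assumes [measurable]: "f \<in> borel_measurable borel" and f: "integrable lborel f"
    and ae: "AE x in lebesgue. f0 x = f x" and f0 [measurable]: "f0 \<in> borel_measurable lebesgue"
    and V: "BV_seminorm f0 \<le> ennreal V" "0 \<le> V"
  shows "(\<integral>\<^sup>+x. ennreal \<bar>f (x + v) - f x\<bar> \<partial>lborel) \<le> ennreal (norm v * V)"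
proof (cases "v = 0")
  case False
  define g where "g x = f x - f (x + v)" for x
  have [measurable]: "g \<in> borel_measurable borel" unfolding g_def by measurable
  have fv: "integrable lborel (\<lambda>x. f (x + v))" by (rule integral_lborel_translate(2)) (use f in auto)
  then have g: "integrable lborel g" unfolding g_def using f by (intro Bochner_Integration.integrable_diff)
  have bd: "integrable lborel (\<lambda>x. h x * \<psi> x)"
    if "integrable lborel h" "continuous_on UNIV \<psi>" "\<And>x. \<bar>\<psi> x\<bar> \<le> 1" for h \<psi> :: "real ^ 'n \<Rightarrow> real"
  proof (rule Bochner_Integration.integrable_bound[OF that(1)])
    have "\<psi> \<in> borel_measurable borel" using that(2) by (rule borel_measurable_continuous_onI)
    then show "(\<lambda>x. h x * \<psi> x) \<in> borel_measurable lborel" using that(1) by simp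
    show "AE x in lborel. norm (h x * \<psi> x) \<le> norm (h x)"
      using that(3) by (auto simp: abs_mult mult_left_le)
  qed
  have "(LINT x|lebesgue. \<bar>g x\<bar>) \<le> norm v * V"
  proof (rule L1_norm_le_by_duality)
    show "integrable lebesgue g" using g by (simp add: integrable_completion)
    fix \<psi> :: "real ^ 'n \<Rightarrow> real" and \<rho>
    assume \<psi>: "smooth \<psi>" "\<And>x. \<rho> < norm x \<Longrightarrow> \<psi> x = 0" "\<And>x. \<bar>\<psi> x\<bar> \<le> 1"
    let ?\<Phi> = "\<lambda>y. segment_average v \<psi> y *\<^sub>R sgn v"
    have test: "?\<Phi> \<in> test_fields"
      by (rule segment_average_test_field(1)[of _ \<rho>]) (use \<psi> False in auto)
    have div: "divergence ?\<Phi> = (\<lambda>y. (\<psi> y - \<psi> (y - v)) / norm v)"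
      by (intro ext segment_average_test_field(2)[of _ \<rho>]) (use \<psi> False in auto)
    have cont: "continuous_on UNIV \<psi>" using \<psi>(1) C_k_continuous by (metis smooth_def)
    then have [measurable]: "\<psi> \<in> borel_measurable borel" by (rule borel_measurable_continuous_onI)
    have contv: "continuous_on UNIV (\<lambda>x. \<psi> (x - v))"
      by (intro continuous_on_compose2[OF cont] continuous_intros) auto
    have i1: "integrable lborel (\<lambda>x. f x * \<psi> x)" by (rule bd[OF f cont \<psi>(3)])
    have i2: "integrable lborel (\<lambda>x. f x * \<psi> (x - v))" by (rule bd[OF f contv \<psi>(3)])
    have i3: "integrable lborel (\<lambda>x. f (x + v) * \<psi> x)" by (rule bd[OF fv cont \<psi>(3)])
    have "ennreal (LINT x|lebesgue. f0 x * divergence ?\<Phi> x) \<le> BV_seminorm f0"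
      unfolding BV_seminorm_def using test by (rule SUP_upper)
    \<comment> \<open>Truncation of the integral at 0 by \<open>ennreal\<close> is harmless because
      V is nonnegative.\<close>
    then have le: "(LINT x|lebesgue. f0 x * divergence ?\<Phi> x) \<le> V"
      using V by (metis ennreal_le_iff order_trans)
    have m0: "(\<lambda>x. (\<psi> x - \<psi> (x - v)) / norm v) \<in> borel_measurable borel" by measurable
    have m: "(\<lambda>x. (\<psi> x - \<psi> (x - v)) / norm v) \<in> borel_measurable lebesgue"
      using m0 by (simp add: measurable_completion)
    have fm: "f \<in> borel_measurable lebesgue" by (simp add: measurable_completion)
    have "(LINT x|lebesgue. f0 x * divergence ?\<Phi> x) = (LINT x|lebesgue. f x * ((\<psi> x - \<psi> (x - v)) / norm v))"
      unfolding div
    proof (intro integral_cong_AE borel_measurable_times f0 fm m)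
      show "AE x in lebesgue. f0 x * ((\<psi> x - \<psi> (x - v)) / norm v) = f x * ((\<psi> x - \<psi> (x - v)) / norm v)"
        using ae by eventually_elim simp
    qed
    also have "\<dots> = (LINT x|lborel. f x * ((\<psi> x - \<psi> (x - v)) / norm v))"
      by (rule integral_completion) measurable
    also have "\<dots> = (LINT x|lborel. f x * \<psi> x - f x * \<psi> (x - v)) / norm v"
      by (simp only: times_divide_eq_right right_diff_distrib integral_divide_zero)
    also have "(LINT x|lborel. f x * \<psi> x - f x * \<psi> (x - v)) = (LINT x|lborel. f x * \<psi> x) - (LINT x|lborel. f x * \<psi> (x - v))"
      by (rule Bochner_Integration.integral_diff[OF i1 i2])
    also have "(LINT x|lborel. f x * \<psi> (x - v)) = (LINT x|lborel. f (x + v) * \<psi> x)"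
      using integral_lborel_translate(1)[of "\<lambda>x. f x * \<psi> (x - v)" v] by simp
    also have "(LINT x|lborel. f x * \<psi> x) - (LINT x|lborel. f (x + v) * \<psi> x) = (LINT x|lborel. g x * \<psi> x)"
      unfolding g_def by (simp add: left_diff_distrib Bochner_Integration.integral_diff[OF i1 i3])
    finally have "(LINT x|lborel. g x * \<psi> x) / norm v \<le> V" using le by simp
    then have "(LINT x|lborel. g x * \<psi> x) \<le> norm v * V" using False by (simp add: field_simps)
    moreover have "(LINT x|lebesgue. g x * \<psi> x) = (LINT x|lborel. g x * \<psi> x)"
      by (rule integral_completion) measurable
    ultimately show "(LINT x|lebesgue. g x * \<psi> x) \<le> norm v * V" by simp
  qed
  then have "(LINT x|lborel. \<bar>g x\<bar>) \<le> norm v * V" by (simp add: integral_completion)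
  moreover have "(\<integral>\<^sup>+x. ennreal \<bar>f (x + v) - f x\<bar> \<partial>lborel) = (\<integral>\<^sup>+x. ennreal \<bar>g x\<bar> \<partial>lborel)"
    by (simp add: g_def abs_minus_commute)
  moreover have "\<dots> = ennreal (LINT x|lborel. \<bar>g x\<bar>)"
    using g by (intro nn_integral_eq_integral) auto
  ultimately show ?thesis by (simp add: ennreal_leI)
qed simp

section \<open>The two Lorentz norm estimates\<close>

lemma Lorentz_norm_le_BV_seminorm:
  fixes f :: "real ^ 'n::finite \<Rightarrow> real"
  assumes "CARD('n) \<ge> 2" and BV: "f \<in> BV" and nonneg: "\<And>x. 0 \<le> f x"
  shows "Lorentz_norm (real CARD('n) / (real CARD('n) - 1)) (\<lambda>x. ereal (f x))
     \<le> ennreal (real CARD('n) / (real CARD('n) - 1) * (8 * real CARD('n))) * BV_seminorm f"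
proof -
  define n where "n = real CARD('n)"
  have n: "2 \<le> n" using assms(1) by (simp add: n_def)
  have f [measurable]: "f \<in> borel_measurable lebesgue" and "BV_norm f < \<infinity>"
    using BV by (auto simp: BV_def)
  then have L1: "(\<integral>\<^sup>+x. ennreal \<bar>f x\<bar> \<partial>lebesgue) < \<infinity>" and "BV_seminorm f < \<infinity>"
    by (auto simp: BV_norm_def)
  then obtain V where V: "BV_seminorm f = ennreal V" "0 \<le> V"
    by (cases "BV_seminorm f") auto
  obtain g' where g' [measurable]: "g' \<in> borel_measurable lborel" and ae': "AE x in lborel. f x = g' x"
    using completion_ex_borel_measurable_real[OF f] by auto
  \<comment> \<open>A Borel representative of f may be negative on a null set; the absolute value
    restores nonnegativity everywhere and agrees with f almost everywhere.\<close>
  define g where "g x = \<bar>g' x\<bar>" for x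
  have g [measurable]: "g \<in> borel_measurable borel" unfolding g_def using g' by simp
  have "AE x in lborel. f x = g x"
    using ae' by eventually_elim (metis abs_of_nonneg g_def nonneg)
  then have ae: "AE x in lebesgue. f x = g x" by (rule AE_completion)
  have gm: "g \<in> borel_measurable lebesgue" using g by (simp add: measurable_completion)
  have "(\<integral>\<^sup>+x. ennreal (g x) \<partial>lborel) = (\<integral>\<^sup>+x. ennreal (g x) \<partial>lebesgue)"
    by (simp add: nn_integral_completion)
  also have "\<dots> = (\<integral>\<^sup>+x. ennreal \<bar>f x\<bar> \<partial>lebesgue)"
  proof (rule nn_integral_cong_AE)
    show "AE x in lebesgue. ennreal (g x) = ennreal \<bar>f x\<bar>"
      using ae by eventually_elim (simp add: g_def)
  qed
  finally have gfin: "(\<integral>\<^sup>+x. ennreal (g x) \<partial>lborel) < \<infinity>" using L1 by simp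
  then have gint: "integrable lborel g"
    by (intro integrableI_bounded) (auto simp: g_def)
  have "(\<integral>\<^sup>+s\<in>{0..}. ennreal_powr (emeasure lborel {x. s < g x}) (1 - 1 / DIM(real ^ 'n)) \<partial>lborel)
     \<le> ennreal (8 * DIM(real ^ 'n) * V)"
    using V by (intro Lorentz_bound_from_translations g gfin L1_translation_le_BV_seminorm[OF g gint ae f])
      (auto simp: g_def)
  moreover have "emeasure lborel {x. s < g x} = distr_fun (\<lambda>x. ereal (f x)) s" for s
  proof -
    have "{x \<in> space lebesgue. s < g x} \<in> sets lebesgue" "{x \<in> space lebesgue. s < f x} \<in> sets lebesgue"
      using gm f by measurable
    then have "emeasure lebesgue {x. s < g x} = emeasure lebesgue {x. s < f x}"
      using ae by (intro emeasure_eq_AE) auto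
    moreover have "emeasure lebesgue {x. s < g x} = emeasure lborel {x. s < g x}"
      by (simp add: emeasure_completion)
    ultimately show ?thesis by (simp add: distr_fun_def nonneg)
  qed
  \<comment> \<open>The isoperimetric exponent is the reciprocal of the Lorentz exponent n / (n -
    1).\<close>
  moreover have "1 - 1 / DIM(real ^ 'n) = 1 / (n / (n - 1))" "real DIM(real ^ 'n) = n"
    using n by (auto simp: n_def field_simps)
  ultimately have "(\<integral>\<^sup>+s\<in>{0..}. ennreal_powr (distr_fun (\<lambda>x. ereal (f x)) s) (1 / (n / (n - 1))) \<partial>lborel) \<le> ennreal (8 * n * V)"
    by (simp only: of_nat_mult of_nat_numeral)
  then have "Lorentz_norm (n / (n - 1)) (\<lambda>x. ereal (f x)) \<le> ennreal (n / (n - 1)) * ennreal (8 * n * V)"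
    unfolding Lorentz_norm_def by (rule mult_left_mono) simp
  also have "\<dots> = ennreal (n / (n - 1) * (8 * n) * V)"
    using n V by (subst ennreal_mult[symmetric]) (auto simp: mult.assoc)
  also have "\<dots> = ennreal (n / (n - 1) * (8 * n)) * BV_seminorm f"
    using n V by (simp only: V(1)) (rule ennreal_mult; auto)
  finally show ?thesis by (simp only: n_def)
qed

theorem mainTheorem3:
  assumes "CARD('n::finite) \<ge> 2"
  shows "(\<forall>\<gamma> \<alpha>. 0 < \<gamma> \<and> \<gamma> < real CARD('n) - 1 \<and> 0 < \<alpha> \<longrightarrow>
           (\<exists>C\<^sub>1::real. C\<^sub>1 > 0 \<and> (\<forall>f \<in> (BV :: (real ^ 'n \<Rightarrow> real) set).
              Lorentz_norm (real CARD('n) / (real CARD('n) - (1 + \<gamma>))) (m_L \<alpha> \<gamma> f)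
                \<le> ennreal C\<^sub>1 *
                  Lorentz_norm (real CARD('n) / (real CARD('n) - 1)) (\<lambda>x. ereal (f x)))))
       \<and> (\<exists>C\<^sub>2::real. C\<^sub>2 > 0 \<and> (\<forall>f \<in> (BV :: (real ^ 'n \<Rightarrow> real) set).
              (\<forall>x. 0 \<le> f x) \<longrightarrow>
              Lorentz_norm (real CARD('n) / (real CARD('n) - 1)) (\<lambda>x. ereal (f x))
                \<le> ennreal C\<^sub>2 * BV_seminorm f))"
proof (intro conjI allI impI)
  fix \<gamma> \<alpha> :: real
  assume "0 < \<gamma> \<and> \<gamma> < real CARD('n) - 1 \<and> 0 < \<alpha>"
  then obtain C where "0 < C" and C: "\<And>f :: real ^ 'n \<Rightarrow> real. f \<in> borel_measurable lebesgue \<Longrightarrow>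
      Lorentz_norm (real CARD('n) / (real CARD('n) - (1 + \<gamma>))) (m_L \<alpha> \<gamma> f)
        \<le> ennreal C * Lorentz_norm (real CARD('n) / (real CARD('n) - 1)) (\<lambda>x. ereal (f x))"
    by (metis Lorentz_norm_m_L_le)
  then show "\<exists>C\<^sub>1::real. C\<^sub>1 > 0 \<and> (\<forall>f \<in> (BV :: (real ^ 'n \<Rightarrow> real) set).
              Lorentz_norm (real CARD('n) / (real CARD('n) - (1 + \<gamma>))) (m_L \<alpha> \<gamma> f)
                \<le> ennreal C\<^sub>1 *
                  Lorentz_norm (real CARD('n) / (real CARD('n) - 1)) (\<lambda>x. ereal (f x)))"
    by (auto simp: BV_def)
next
  have "0 < real CARD('n) / (real CARD('n) - 1) * (8 * real CARD('n))" using assms by simp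
  then show "\<exists>C\<^sub>2::real. C\<^sub>2 > 0 \<and> (\<forall>f \<in> (BV :: (real ^ 'n \<Rightarrow> real) set).
              (\<forall>x. 0 \<le> f x) \<longrightarrow>
              Lorentz_norm (real CARD('n) / (real CARD('n) - 1)) (\<lambda>x. ereal (f x))
                \<le> ennreal C\<^sub>2 * BV_seminorm f)"
    using Lorentz_norm_le_BV_seminorm[OF assms] by blast
qed

end
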